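(* There exist two families of bijections $\psi_{\mathrm{inv}}$ and $\psi_{\mathrm{quinv}}$, giving for every $n\ge 1$ and every partition $\lambda=(\lambda_1\ge\lambda_2\ge\cdots\ge\lambda_n\ge 0)$ with at most $n$ nonzero parts two bijections $\psi_{\mathrm{inv}},\psi_{\mathrm{quinv}}:\mathrm{CSF}(\lambda)\to\mathrm{POP}(\lambda)$ with the following properties. 1. For $v=\mathrm{inv}$ or $v=\mathrm{quinv}$ and $F\in\mathrm{CSF}(\lambda)$: if $\psi_v(F)=(T,\Lambda)$, then $x^F=x^T$ and $v(F)=|\Lambda|$. 2. For $v=\mathrm{inv}$ or $v=\mathrm{quinv}$: (A) $\mathrm{pr}\circ\psi_v=\mathrm{rsort}$ as maps $\mathrm{CSF}(\lambda)\to\mathrm{GT}(\lambda)$; (B) $\mathrm{br}\circ\psi_v=\psi_v\circ\mathrm{dsplice}$ as maps $\mathrm{CSF}(\lambda)\to\bigsqcup_{\mu\prec\lambda}\mathrm{POP}(\mu)$, where on the right-hand side $\psi_v:\bigsqcup_{\mu\prec\lambda}\mathrm{CSF}(\mu)\to\bigsqcup_{\mu\prec\lambda}\mathrm{POP}(\mu)$ is the disjoint union of the bijections $\psi_v:\mathrm{CSF}(\mu)\to\mathrm{POP}(\mu)$ of the family attached to $n-1$ and $\mu$ (here $\mathrm{CSF}(\mu)$ denotes column strict fillings of $\mu$ with entries in $[n-1]$). 3. $\psi_{\mathrm{quinv}}=\mathrm{bcomp}\circ\psi_{\mathrm{inv}}$ as maps $\mathrm{CSF}(\lambda)\to\ma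thrm{POP}(\lambda)$.
   Context: Diagrams and fillings. $[n]=\{1,\dots,n\}$. The Young diagram $\mathrm{dg}(\lambda)$ is drawn in English convention (row $i$ from the top has $\lambda_i$ boxes (cells), left-justified). A filling is a map $F:\mathrm{dg}(\lambda)\to[n]$; its $x$-weight is $x^F=\prod_{c\in\mathrm{dg}(\lambda)}x_{F(c)}$. $\mathrm{CSF}(\lambda)$ is the set of column strict fillings: those whose values strictly increase going down each column (no condition on rows). GT patterns. $\mathrm{GT}(\lambda)$ is the set of integral Gelfand-Tsetlin patterns with bounding row $\lambda$: arrays $T=(T^j_i)_{1\le i\le j\le n}$ of integers with $T^n_i=\lambda_i$ and $T^{j+1}_i\ge T^j_i\ge T^{j+1}_{i+1}$. Put $\mathrm{NE}_{ij}(T)=T^{j+1}_i-T^j_i$ and $\mathrm{SE}_{ij}(T)=T^j_i-T^{j+1}_{i+1}$ for $1\le i\le j<n$. $T$ is identified with the semistandard Young tableau (rows weakly increasing, columns strictly increasing, entries in $[n]$) of shape $\lambda$ for which $(T^j_1,\dots,T^j_j)$ is the shape formed by the cells with entries $\le j$; $x^T$ is the $x$-weight of this tableau. POPs. A partition overlaid pattern of shape $\lambda$ is a pair $(T,\Lambda)$ with $T\in\mathrm{GT}(\lambda)$ and $\Lambda=(\Lambda_{ij}:1\le i\le j<n)$ a tuple of partitions such that $\Lambda_{ij}$ fits in an $\mathrm{NE}_{ij}(T)\times\mathrm{SE}_{ij}(T)$ rectangle, where a partition fits in a $k\times\ell$ rectangle if it is of the form $\gamma_1\ge\cdots\ge\gamma_k\ge0$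 with $\gamma_1\le\ell$. $\mathrm{POP}(\lambda)$ is the set of these, and $|\Lambda|=\sum_{i,j}|\Lambda_{ij}|$. Maps on POPs. $\mathrm{pr}(T,\Lambda)=T$. For $\mu=(\mu_1,\dots,\mu_{n-1})$, $\mu\prec\lambda$ means $\lambda_i\ge\mu_i\ge\lambda_{i+1}$ for $1\le i<n$. The map $\mathrm{br}:\mathrm{POP}(\lambda)\to\bigsqcup_{\mu\prec\lambda}\mathrm{POP}(\mu)$ (POPs of shape $\mu$ defined with $n-1$ in place of $n$) sends $(T,\Lambda)$ to $(T^\dagger,\Lambda^\dagger)$, where $T^\dagger$ is $T$ with the bounding row $T^n$ deleted and $\Lambda^\dagger$ is $\Lambda$ with the $\Lambda_{i,n-1}$ deleted. The complement of $\pi=(\pi_1\ge\cdots\ge\pi_k\ge0)$ in a $k\times\ell$ rectangle is $(\ell-\pi_k\ge\cdots\ge\ell-\pi_1)$; $\mathrm{bcomp}(T,\Lambda)=(T,\Lambda^c)$, where $(\Lambda^c)_{ij}$ is the complement of $\Lambda_{ij}$ in the $\mathrm{NE}_{ij}(T)\times\mathrm{SE}_{ij}(T)$ rectangle. For $n=1$, $\mu$ is the empty tuple, $\mathrm{CSF}(\mu)$ and $\mathrm{POP}(\mu)$ are one-element sets, and $\psi_v$ on them is the unique map. Maps on CSFs. $\mathrm{rsort}(F)$ sorts the entries of each row of $F$ in ascending order; for $F\in\mathrm{CSF}(\lambda)$ it is a semistandard tableau, hence an element of $\mathrm{GT}(\lambda)$. A column tuple is a strictly increasing (possibly empty) finite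 sequence of positive integers. For column tuples $\sigma=(\sigma_1<\cdots<\sigma_{\ell-1})$, $\tau=(\tau_1<\cdots<\tau_\ell)$, $\ell\ge1$, set $\sigma_0=0$, let $k=\max\{1\le i\le\ell:\sigma_{i-1}<\tau_i\}$, and let $\mathrm{splice}(\sigma,\tau)=(\overline\sigma,\overline\tau)$ with $\overline\sigma=(\sigma_1,\dots,\sigma_{k-1},\tau_k,\dots,\tau_\ell)$, $\overline\tau=(\tau_1,\dots,\tau_{k-1},\sigma_k,\dots,\sigma_{\ell-1})$. The map $\mathrm{dsplice}:\mathrm{CSF}(\lambda)\to\bigsqcup_{\mu\prec\lambda}\mathrm{CSF}(\mu)$ is: delete all cells of $F$ containing $n$; as long as the resulting column lengths do not form a partition shape, choose any $j$ such that the $(j+1)$-st column is longer (necessarily by exactly one) than the $j$-th column, and replace the pair (column $j$, column $j+1$) by its splice; stop when the shape is a partition. The result does not depend on the choices of $j$. Statistics. Let $F\in\mathrm{CSF}(\lambda)$. $\mathrm{quinv}(F)$ is the number of triples of cells $(x,y,z)$ with $x,z\in\mathrm{dg}(\lambda)$ in the same row, $z$ to the right of $x$, $y$ the position immediately below $x$ in its column, and $F(x)<F(z)<F(y)$, where $F(y)=\infty$ if $y\notin\mathrm{dg}(\lambda)$. $\mathrm{inv}(F)$ is the Haglund-Haiman-Loehr statistic, in English convention: two cells attack each other if they are in the same row, or are in rows $i$ and $i+1$ with the cell in row $i+1$ in a column strictly to the right of that of the cell in row $i$. The reading order goes through the rows from the lowest row to the top row, left to right in each row. $\mathrm{Inv}(F)$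 is the set of pairs of attacking cells $\{u,w\}$ with $u$ preceding $w$ in reading order and $F(u)>F(w)$. $\mathrm{Des}(F)$ is the set of cells $u$ not in the top row with $F(u)$ greater than the entry of the cell immediately above $u$. $\mathrm{arm}(u)$ is the number of cells strictly to the right of $u$ in its row. Then $\mathrm{inv}(F)=|\mathrm{Inv}(F)|-\sum_{u\in\mathrm{Des}(F)}\mathrm{arm}(u)$. *)

theory Defs
  imports "HOL-Library.FuncSet" "HOL-Library.Poly_Mapping"
begin

text \<open>
  All indices start at 1. Finitely indexed families (partitions, fillings, patterns, overlays) are
  functions that are extensional on their index set, so that equality of the objects is
  equality in HOL. The number \<open>n\<close> is always an explicit parameter.
\<close>

type_synonym cell = "nat \<times> nat"
type_synonym part = "nat \<Rightarrow> nat"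
type_synonym filling = "cell \<Rightarrow> nat"
type_synonym pattern = "nat \<times> nat \<Rightarrow> nat"
type_synonym overlay = "nat \<times> nat \<Rightarrow> nat list"
type_synonym pop = "pattern \<times> overlay"


section \<open>Diagrams, fillings, weights\<close>

definition partitions :: "nat \<Rightarrow> part set" where
  "partitions n = {lam \<in> {1..n} \<rightarrow>\<^sub>E UNIV. \<forall>i. 1 \<le> i \<and> i < n \<longrightarrow> lam (Suc i) \<le> lam i}"

text \<open>Cells are pairs (row, column), with rows numbered from the top.\<close>

definition dg :: "nat \<Rightarrow> part \<Rightarrow> cell set" where
  "dg n lam = {(i, j). 1 \<le> i \<and> i \<le> n \<and> 1 \<le> j \<and> j \<le> lam i}"

definition fillings :: "nat \<Rightarrow> part \<Rightarrow> filling set" where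
  "fillings n lam = dg n lam \<rightarrow>\<^sub>E {1..n}"

definition column_strict :: "nat \<Rightarrow> part \<Rightarrow> filling \<Rightarrow> bool" where
  "column_strict n lam F \<longleftrightarrow>
     (\<forall>i j. (i, j) \<in> dg n lam \<and> (Suc i, j) \<in> dg n lam \<longrightarrow> F (i, j) < F (Suc i, j))"

definition row_weak :: "nat \<Rightarrow> part \<Rightarrow> filling \<Rightarrow> bool" where
  "row_weak n lam F \<longleftrightarrow>
     (\<forall>i j. (i, j) \<in> dg n lam \<and> (i, Suc j) \<in> dg n lam \<longrightarrow> F (i, j) \<le> F (i, Suc j))"

definition CSF :: "nat \<Rightarrow> part \<Rightarrow> filling set" where
  "CSF n lam = {F \<in> fillings n lam. column_strict n lam F}"

definition SSYT :: "nat \<Rightarrow> part \<Rightarrow> filling set" where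
  "SSYT n lam = {F \<in> fillings n lam. row_weak n lam F \<and> column_strict n lam F}"

text \<open>
  The polynomial ring over the integers in variables \<open>x\<^sub>1, x\<^sub>2, \<dots>\<close>: a polynomial maps exponent
  vectors to coefficients.
\<close>

type_synonym mpoly = "(nat \<Rightarrow>\<^sub>0 nat) \<Rightarrow>\<^sub>0 int"

definition xvar :: "nat \<Rightarrow> mpoly" where
  "xvar i = Poly_Mapping.single (Poly_Mapping.single i 1) 1"

definition xweight :: "nat \<Rightarrow> part \<Rightarrow> filling \<Rightarrow> mpoly" where
  "xweight n lam F = (\<Prod>c\<in>dg n lam. xvar (F c))"


section \<open>Gelfand-Tsetlin patterns\<close>

definition triangle :: "nat \<Rightarrow> (nat \<times> nat) set" where
  "triangle n = {(i, j). 1 \<le> i \<and> i \<le> j \<and> j \<le> n}"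

text \<open>
  \<open>T (i, j)\<close> is the \<open>i\<close>-th entry of row \<open>j\<close>. By interlacing, every entry is bounded
  below by an entry of the bounding row \<open>lam\<close>, so taking natural number entries excludes no
  integral pattern.
\<close>

definition GT :: "nat \<Rightarrow> part \<Rightarrow> pattern set" where
  "GT n lam = {T \<in> triangle n \<rightarrow>\<^sub>E UNIV.
     (\<forall>i\<in>{1..n}. T (i, n) = lam i) \<and>
     (\<forall>i j. 1 \<le> i \<and> i \<le> j \<and> j < n \<longrightarrow>
        T (i, j) \<le> T (i, Suc j) \<and> T (Suc i, Suc j) \<le> T (i, j))}"

text \<open>The truncated subtractions below are genuine on \<open>GT n lam\<close>.\<close>

definition NE :: "pattern \<Rightarrow> nat \<Rightarrow> nat \<Rightarrow> nat" where
  "NE T i j = T (i, Suc j) - T (i, j)"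

definition SE :: "pattern \<Rightarrow> nat \<Rightarrow> nat \<Rightarrow> nat" where
  "SE T i j = T (i, j) - T (Suc i, Suc j)"

text \<open>
  The identification of tableaux with patterns: row \<open>j\<close> of the pattern is the shape formed by
  the cells with entries at most \<open>j\<close>.
\<close>

definition gt_of_tableau :: "nat \<Rightarrow> part \<Rightarrow> filling \<Rightarrow> pattern" where
  "gt_of_tableau n lam S =
     (\<lambda>(i, j)\<in>triangle n. card {c. (i, c) \<in> dg n lam \<and> S (i, c) \<le> j})"

definition tableau_of_gt :: "nat \<Rightarrow> part \<Rightarrow> pattern \<Rightarrow> filling" where
  "tableau_of_gt n lam = the_inv_into (SSYT n lam) (gt_of_tableau n lam)"

definition xweight_gt :: "nat \<Rightarrow> part \<Rightarrow> pattern \<Rightarrow> mpoly" where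
  "xweight_gt n lam T = xweight n lam (tableau_of_gt n lam T)"


section \<open>Partition overlaid patterns\<close>

text \<open>
  A partition fitting in a \<open>k \<times> l\<close> rectangle is stored with exactly \<open>k\<close> parts, zeros
  included, so each such partition has one representative.
\<close>

definition fits :: "nat \<Rightarrow> nat \<Rightarrow> nat list set" where
  "fits k l = {g. length g = k \<and> sorted_wrt (\<ge>) g \<and> (\<forall>p\<in>set g. p \<le> l)}"

definition overlay_index :: "nat \<Rightarrow> (nat \<times> nat) set" where
  "overlay_index n = {(i, j). 1 \<le> i \<and> i \<le> j \<and> j < n}"

definition POP :: "nat \<Rightarrow> part \<Rightarrow> pop set" where
  "POP n lam =
     (SIGMA T:GT n lam. PiE (overlay_index n) (\<lambda>(i, j). fits (NE T i j) (SE T i j)))"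

definition overlay_size :: "nat \<Rightarrow> overlay \<Rightarrow> nat" where
  "overlay_size n L = (\<Sum>(i, j)\<in>overlay_index n. sum_list (L (i, j)))"

definition interlacing :: "nat \<Rightarrow> part \<Rightarrow> part set" where
  "interlacing n lam =
     {mu \<in> {1..n-1} \<rightarrow>\<^sub>E UNIV. \<forall>i. 1 \<le> i \<and> i < n \<longrightarrow> lam (Suc i) \<le> mu i \<and> mu i \<le> lam i}"

text \<open>
  Elements of the disjoint unions over \<open>mu \<in> interlacing n lam\<close> are pairs whose first
  component is \<open>mu\<close>; for \<open>br\<close> this is the new bounding row.
\<close>

definition pr :: "pop \<Rightarrow> pattern" where
  "pr P = fst P"

definition br :: "nat \<Rightarrow> pop \<Rightarrow> part \<times> pop" where
  "br n = (\<lambda>(T, L).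
     (\<lambda>i\<in>{1..n-1}. T (i, n-1),
      (restrict T (triangle (n-1)), restrict L (overlay_index (n-1)))))"

definition complement :: "nat \<Rightarrow> nat list \<Rightarrow> nat list" where
  "complement l g = map (\<lambda>p. l - p) (rev g)"

definition bcomp :: "nat \<Rightarrow> pop \<Rightarrow> pop" where
  "bcomp n = (\<lambda>(T, L). (T, \<lambda>(i, j)\<in>overlay_index n. complement (SE T i j) (L (i, j))))"


section \<open>Row sorting and deletion with splicing\<close>

definition rsort :: "nat \<Rightarrow> part \<Rightarrow> filling \<Rightarrow> filling" where
  "rsort n lam F =
     (\<lambda>(i, j)\<in>dg n lam. sort (map (\<lambda>c. F (i, c)) [1..<Suc (lam i)]) ! (j - 1))"

text \<open>
  Column tuples are lists. In \<open>col_splice\<close>, where \<open>length tau = Suc (length sigma)\<close>, the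
  list \<open>0 # sigma\<close> supplies the convention \<open>sigma\<^sub>0 = 0\<close>, so that its entry at
  position \<open>i - 1\<close> is the one with index \<open>i - 1\<close>, while list position \<open>i - 1\<close>
  of \<open>tau\<close> holds the entry with index \<open>i\<close>.
\<close>

definition col_splice :: "nat list \<Rightarrow> nat list \<Rightarrow> nat list \<times> nat list" where
  "col_splice sigma tau =
     (let k = Max {i \<in> {1..length tau}. (0 # sigma) ! (i - 1) < tau ! (i - 1)}
      in (take (k - 1) sigma @ drop (k - 1) tau, take (k - 1) tau @ drop (k - 1) sigma))"

definition columns :: "nat \<Rightarrow> part \<Rightarrow> filling \<Rightarrow> nat list list" where
  "columns n lam F =
     map (\<lambda>j. map (\<lambda>i. F (i, j)) [1..<Suc (card {i. (i, j) \<in> dg n lam})]) [1..<Suc (lam 1)]"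

inductive splice_step :: "nat list list \<Rightarrow> nat list list \<Rightarrow> bool" where
  "\<lbrakk>Suc j < length C; length (C ! j) < length (C ! Suc j);
    col_splice (C ! j) (C ! Suc j) = (s, t)\<rbrakk>
   \<Longrightarrow> splice_step C (C[j := s, Suc j := t])"

definition partition_shaped :: "nat list list \<Rightarrow> bool" where
  "partition_shaped C \<longleftrightarrow> sorted_wrt (\<ge>) (map length C)"

text \<open>
  The steps may be applied at any choice of adjacent columns. The definite description is
  meaningful because the final list of columns does not depend on these choices.
\<close>

definition dsplice_columns :: "nat \<Rightarrow> part \<Rightarrow> filling \<Rightarrow> nat list list" where
  "dsplice_columns n lam F =
     (THE D. splice_step\<^sup>*\<^sup>* (map (filter (\<lambda>a. a \<noteq> n)) (columns n lam F)) D \<and> partition_shaped D)"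

definition shape_of_columns :: "nat \<Rightarrow> nat list list \<Rightarrow> part" where
  "shape_of_columns m D = (\<lambda>i\<in>{1..m}. card {j. j < length D \<and> i \<le> length (D ! j)})"

definition filling_of_columns :: "nat \<Rightarrow> nat list list \<Rightarrow> filling" where
  "filling_of_columns m D =
     (\<lambda>(i, j)\<in>dg m (shape_of_columns m D). D ! (j - 1) ! (i - 1))"

definition dsplice :: "nat \<Rightarrow> part \<Rightarrow> filling \<Rightarrow> part \<times> filling" where
  "dsplice n lam F =
     (let D = dsplice_columns n lam F
      in (shape_of_columns (n - 1) D, filling_of_columns (n - 1) D))"


section \<open>Statistics\<close>

text \<open>An entry immediately below \<open>x\<close> outside the diagram counts as infinity.\<close>

definition quinv_triples :: "nat \<Rightarrow> part \<Rightarrow> filling \<Rightarrow> (cell \<times> cell \<times> cell) set" where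
  "quinv_triples n lam F =
     {(x, y, z). x \<in> dg n lam \<and> z \<in> dg n lam \<and>
        fst z = fst x \<and> snd x < snd z \<and> y = (Suc (fst x), snd x) \<and>
        F x < F z \<and> (y \<in> dg n lam \<longrightarrow> F z < F y)}"

definition quinv_stat :: "nat \<Rightarrow> part \<Rightarrow> filling \<Rightarrow> int" where
  "quinv_stat n lam F = int (card (quinv_triples n lam F))"

definition attack :: "cell \<Rightarrow> cell \<Rightarrow> bool" where
  "attack u w \<longleftrightarrow>
     (fst u = fst w \<and> snd u \<noteq> snd w) \<or>
     (fst w = Suc (fst u) \<and> snd u < snd w) \<or>
     (fst u = Suc (fst w) \<and> snd w < snd u)"

definition precedes :: "cell \<Rightarrow> cell \<Rightarrow> bool" where
  "precedes u w \<longleftrightarrow> fst w < fst u \<or> (fst u = fst w \<and> snd u < snd w)"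

definition Inv_pairs :: "nat \<Rightarrow> part \<Rightarrow> filling \<Rightarrow> (cell \<times> cell) set" where
  "Inv_pairs n lam F =
     {(u, w). u \<in> dg n lam \<and> w \<in> dg n lam \<and> attack u w \<and> precedes u w \<and> F w < F u}"

definition Des :: "nat \<Rightarrow> part \<Rightarrow> filling \<Rightarrow> cell set" where
  "Des n lam F = {u \<in> dg n lam. fst u \<noteq> 1 \<and> F (fst u - 1, snd u) < F u}"

definition arm :: "nat \<Rightarrow> part \<Rightarrow> cell \<Rightarrow> nat" where
  "arm n lam u = card {w \<in> dg n lam. fst w = fst u \<and> snd u < snd w}"

definition inv_stat :: "nat \<Rightarrow> part \<Rightarrow> filling \<Rightarrow> int" where
  "inv_stat n lam F =
     int (card (Inv_pairs n lam F)) - (\<Sum>u\<in>Des n lam F. int (arm n lam u))"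

end

(*
  Write q A B for the number of rows i with A_i < B_i < A_(i+1), entries beyond the end of a column
  being infinite. Then quinv is the sum of q A B, and inv the sum of q B A, over the pairs of columns
  with A left of B. As [A_i < B_i < A_(i+1)] = [A_i < B_i] - [A_(i+1) <= B_i] for finite B_i, and
  q A A = 0, the sum inv + quinv of q over all ordered pairs depends on the row multisets only: it
  is the sum of the NE_ij * SE_ij of the row-sorted tableau, so psi_inv can be taken as bcomp after
  psi_quinv.

  A splice exchanges the lower parts of two neighbouring columns, is undone by the splice of the
  exchanged pair, and preserves row multisets and quinv; splices applicable at different places
  never overlap, so the final column list is unique. Deleting n lowers quinv by the number of pairs
  of columns of equal length whose right member, but not the left one, contains n. For the columns
  of length i the positions of n form a binary word, that is, a partition in the
  NE_(i,n-1) x SE_(i,n-1) rectangle, whose size is that number. These words together with the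
  result of dsplice determine the filling, which gives psi_quinv by recursion on n.
*)
theory Submission
  imports "HOL-Library.Multiset" "HOL-Library.Extended_Nat" Defs
begin

section \<open>Splicing two columns\<close>

text \<open>Between deletion and result the columns need not form a diagram, so the argument runs
  over column lists. They are controlled by the list \<open>c\<close> of column lengths before the
  deletion: it decreases weakly, splicing never changes it, and each current column falls short of
  its entry in \<open>c\<close> by at most one. This bound alone makes a longer right neighbour
  longer by exactly one and keeps applicable splices apart. Reversal rests on lengths only. Where a
  splice applies is visible from the lengths, without the entries, and the words prescribe the
  lengths right after the deletion. Emptied columns are kept, because they still have an entry in
  \<open>c\<close>. The obstacle in counting is that \<open>q A B\<close> compares
  \<open>B_i\<close> with two consecutive entries of \<open>A\<close>, which a splice may separate;
  splitting the bracket into two comparisons therefore serves single splices as well. The loss under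
  deletion comes from the rows with \<open>B_i = n\<close>: they count only if
  \<open>A_i < n\<close> and \<open>A_(i+1)\<close> is infinite, that is, if \<open>A\<close> ends
  in the same row and lacks \<open>n\<close>.\<close>

definition column :: "nat \<Rightarrow> nat list \<Rightarrow> bool" where
  "column m A \<longleftrightarrow> sorted_wrt (<) A \<and> set A \<subseteq> {1..m}"

lemma column_nth_less: "column m A \<Longrightarrow> i < j \<Longrightarrow> j < length A \<Longrightarrow> A ! i < A ! j"
  by (simp add: column_def sorted_wrt_nth_less)

lemma column_nth_bounds: "column m A \<Longrightarrow> i < length A \<Longrightarrow> 1 \<le> A ! i \<and> A ! i \<le> m"
  unfolding column_def by (meson atLeastAtMost_iff nth_mem subsetD)

lemma column_nth_ge: "column m A \<Longrightarrow> i < length A \<Longrightarrow> Suc i \<le> A ! i"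
proof (induction i)
  case 0 then show ?case using column_nth_bounds by force
next
  case (Suc i) then show ?case using column_nth_less[of m A i "Suc i"] by simp
qed

lemma column_length: "column m A \<Longrightarrow> length A \<le> m"
  using column_nth_ge[of m A "length A - 1"] column_nth_bounds[of m A "length A - 1"]
  by (cases "length A") auto

lemma columnI:
  assumes "\<And>i. Suc i < length A \<Longrightarrow> A ! i < A ! Suc i"
    and "\<And>i. i < length A \<Longrightarrow> 1 \<le> A ! i \<and> A ! i \<le> m"
  shows "column m A"
  unfolding column_def using assms
  by (auto simp: sorted_wrt_iff_nth_Suc_transp in_set_conv_nth)

text \<open>The cut in terms of inequalities: the first \<open>k\<close> rows stay and the rest is
  exchanged, so \<open>Suc k\<close> is the index found as a maximum in \<open>col_splice\<close>.
  The case \<open>k = 0\<close> corresponds to \<open>sigma\<^sub>0 = 0\<close>. In this form the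
  condition can be checked for the exchanged pair without computing a maximum.\<close>

definition splices_at :: "nat \<Rightarrow> nat list \<Rightarrow> nat list \<Rightarrow> bool" where
  "splices_at k S T \<longleftrightarrow> k \<le> length S \<and> (k > 0 \<longrightarrow> S ! (k - 1) < T ! k) \<and>
     (\<forall>p. k \<le> p \<and> p < length S \<longrightarrow> T ! Suc p \<le> S ! p)"

lemma ex_splices_at:
  assumes "length T = Suc (length S)"
  shows "\<exists>k. splices_at k S T"
proof -
  \<comment> \<open>The added \<open>0\<close> keeps the set nonempty: cutting above the top row is
    always possible.\<close>
  let ?K = "insert 0 {i. i > 0 \<and> i \<le> length S \<and> S ! (i - 1) < T ! i}"
  have fin: "finite ?K" by (simp add: finite_subset[of _ "{..length S}"] subset_iff)
  have mem: "Max ?K \<in> ?K" by (rule Max_in) (use fin in auto)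
  have big: "T ! Suc p \<le> S ! p" if "Max ?K \<le> p" "p < length S" for p
  proof (rule ccontr)
    assume "\<not> T ! Suc p \<le> S ! p"
    then have "Suc p \<in> ?K" using that by simp
    then have "Suc p \<le> Max ?K" using fin by (rule Max_ge[rotated])
    then show False using that(1) by linarith
  qed
  show ?thesis unfolding splices_at_def
    by (rule exI[of _ "Max ?K"]) (use mem big in auto)
qed

lemma col_splice_eq:
  assumes "splices_at k S T" "column m T" "length T = Suc (length S)"
  shows "col_splice S T = (take k S @ drop k T, take k T @ drop k S)"
proof -
  have "Max {i \<in> {1..length T}. (0 # S) ! (i - 1) < T ! (i - 1)} = Suc k"
  proof (rule Max_eqI)
    fix y assume "y \<in> {i \<in> {1..length T}. (0 # S) ! (i - 1) < T ! (i - 1)}"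
    then have y: "1 \<le> y" "y \<le> length T" "(0 # S) ! (y - 1) < T ! (y - 1)" by auto
    show "y \<le> Suc k"
    proof (rule ccontr)
      assume "\<not> y \<le> Suc k"
      then obtain p where p: "y = Suc (Suc p)" "k \<le> p" by (cases y; cases "y - 1") auto
      then have "T ! Suc p \<le> S ! p" using assms y unfolding splices_at_def by auto
      then show False using y p by simp
    qed
  next
    show "Suc k \<in> {i \<in> {1..length T}. (0 # S) ! (i - 1) < T ! (i - 1)}"
      using assms column_nth_bounds[of m T 0]
      by (cases k) (auto simp: splices_at_def Suc_le_eq)
  qed simp
  then show ?thesis by (simp add: col_splice_def)
qed

text \<open>Reading past the end gives infinity. This is the convention for the missing cell in
  quinv, and it lets a splice act row by row although the two columns differ in length.\<close>

definition ent :: "nat list \<Rightarrow> nat \<Rightarrow> enat" where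
  "ent A i = (if i < length A then enat (A ! i) else \<infinity>)"

text \<open>The last two facts present the splice as an exchange of the two entries in every row
  from \<open>k\<close> on; this is the form in which it enters the counting arguments.\<close>

lemma splice_cases:
  assumes "column m S" "column m T" "length T = Suc (length S)" "col_splice S T = (U, V)"
  obtains k where "splices_at k S T" "U = take k S @ drop k T" "V = take k T @ drop k S"
    "\<And>i. ent U i = (if i < k then ent S i else ent T i)"
    "\<And>i. ent V i = (if i < k then ent T i else ent S i)"
proof -
  obtain k where k: "splices_at k S T" using ex_splices_at assms by blast
  have e: "U = take k S @ drop k T" "V = take k T @ drop k S"
    using col_splice_eq[OF k] assms by auto
  show ?thesis
    by (rule that[OF k e]) (use k assms in \<open>auto simp: e ent_def nth_append splices_at_def\<close>)
qed

text \<open>The pair \<open>(V, U)\<close> has the same cut \<open>k\<close>: at the seam the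
  comparison becomes \<open>T ! (k - 1) < T ! k\<close>, and below it the entries of
  \<open>V\<close> and \<open>U\<close> are those of \<open>S\<close> and \<open>T\<close>.
  Exchanging the tails once more restores the columns.\<close>

lemma splice_inverse:
  assumes "column m S" "column m T" "length T = Suc (length S)" "col_splice S T = (U, V)"
  shows "column m U" "column m V" "length U = Suc (length V)" "length V = length S"
    "col_splice V U = (T, S)"
proof -
  obtain k where k: "splices_at k S T" and e: "U = take k S @ drop k T" "V = take k T @ drop k S"
    using splice_cases[OF assms] by blast
  have kl: "k \<le> length S" and lo: "k > 0 \<Longrightarrow> S ! (k - 1) < T ! k"
    and hi: "\<And>p. k \<le> p \<Longrightarrow> p < length S \<Longrightarrow> T ! Suc p \<le> S ! p"
    using k by (auto simp: splices_at_def)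
  have nU: "U ! i = (if i < k then S ! i else T ! i)" if "i < length T" for i
    using that kl assms(3) by (auto simp: e nth_append)
  have nV: "V ! i = (if i < k then T ! i else S ! i)" if "i < length S" for i
    using that kl assms(3) by (auto simp: e nth_append)
  show lU: "length U = Suc (length V)" and lV: "length V = length S" using kl assms(3) by (auto simp: e)
  show U: "column m U"
  proof (rule columnI)
    fix i assume "Suc i < length U"
    then show "U ! i < U ! Suc i"
      using lU lV lo kl assms(3) column_nth_less[OF assms(1), of i "Suc i"]
        column_nth_less[OF assms(2), of i "Suc i"]
      by (cases "Suc i = k") (auto simp: nU)
  next
    fix i assume "i < length U"
    then show "1 \<le> U ! i \<and> U ! i \<le> m"
      using lU lV kl assms(3) column_nth_bounds[OF assms(1), of i]
        column_nth_bounds[OF assms(2), of i] by (auto simp: nU)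
  qed
  show "column m V"
  proof (rule columnI)
    fix i assume i: "Suc i < length V"
    show "V ! i < V ! Suc i"
    proof (cases "Suc i = k")
      case True
      \<comment> \<open>At the seam of \<open>V\<close> the entry \<open>T ! (k - 1)\<close> is
        followed by \<open>S ! k\<close>. As no later cut is possible,
        \<open>T ! Suc k \<le> S ! k\<close>, so \<open>T ! Suc k\<close> separates the two.\<close>
      then have "T ! i < T ! Suc (Suc i)" "T ! Suc (Suc i) \<le> S ! Suc i"
        using hi[of "Suc i"] i lV assms(3) column_nth_less[OF assms(2), of i "Suc (Suc i)"] by auto
      then show ?thesis using True i lV by (simp add: nV)
    next
      case False
      then show ?thesis
        using i lV assms(3) column_nth_less[OF assms(1), of i "Suc i"]
          column_nth_less[OF assms(2), of i "Suc i"] by (auto simp: nV)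
    qed
  next
    fix i assume "i < length V"
    then show "1 \<le> V ! i \<and> V ! i \<le> m"
      using lV kl assms(3) column_nth_bounds[OF assms(1), of i]
        column_nth_bounds[OF assms(2), of i] by (auto simp: nV)
  qed
  have "splices_at k V U"
    unfolding splices_at_def
  proof (intro conjI impI allI)
    assume "0 < k"
    then show "V ! (k - 1) < U ! k"
      using kl assms(3) column_nth_less[OF assms(2), of "k - 1" k] by (simp add: nU nV)
  qed (use kl hi lV assms(3) in \<open>auto simp: nU nV\<close>)
  from col_splice_eq[OF this U lU] show "col_splice V U = (T, S)"
    using kl assms(3) by (simp add: e)
qed


section \<open>The triple count of two columns\<close>

text \<open>Both statistics are sums of \<open>qcount\<close> over pairs of columns \<open>A\<close> left of \<open>B\<close>:
  \<open>qcount A B\<close> for quinv and \<open>qcount B A\<close> for inv.\<close>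

definition qset :: "nat list \<Rightarrow> nat list \<Rightarrow> nat set" where
  "qset A B = {i. ent A i < ent B i \<and> ent B i < ent A (Suc i)}"

definition qcount :: "nat list \<Rightarrow> nat list \<Rightarrow> nat" where
  "qcount A B = card (qset A B)"

lemma qset_subset: "qset A B \<subseteq> {..<length B}"
  by (auto simp: qset_def ent_def split: if_splits)

lemma finite_qset [simp]: "finite (qset A B)"
  using qset_subset finite_subset by blast

lemma ent_mono: "column m A \<Longrightarrow> ent A i \<noteq> \<infinity> \<Longrightarrow> ent A i < ent A (Suc i)"
  by (auto simp: ent_def column_nth_less)

lemma card_eq_sum_of_bool:
  "X \<subseteq> {..<M :: nat} \<Longrightarrow> int (card X) = (\<Sum>i<M. of_bool (i \<in> X))"
  by (simp add: Int_absorb1)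

lemma ent_infinity_Suc: "ent A i = \<infinity> \<Longrightarrow> ent A (Suc i) = \<infinity>"
  by (auto simp: ent_def split: if_splits)

text \<open>Membership in \<open>qset A B\<close> reads two consecutive rows of \<open>A\<close>;
  after the split each indicator reads a single one. The difference is 0 or 1, because for finite
  \<open>ent B i\<close> the second condition implies the first by strictness of \<open>A\<close>.
  The free bound \<open>M\<close> gives columns of different length a common range.\<close>

lemma qcount_expand:
  assumes "column m A" "length B \<le> M"
  shows "int (qcount A B) = (\<Sum>i<M. of_bool (ent A i < ent B i \<and> ent B i \<noteq> \<infinity>)
    - of_bool (ent A (Suc i) \<le> ent B i \<and> ent B i \<noteq> \<infinity>))"
proof -
  have "int (qcount A B) = (\<Sum>i<M. of_bool (i \<in> qset A B))"
    unfolding qcount_def by (rule card_eq_sum_of_bool) (use qset_subset assms in fastforce)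
  also have "\<dots> = (\<Sum>i<M. of_bool (ent A i < ent B i \<and> ent B i \<noteq> \<infinity>)
    - of_bool (ent A (Suc i) \<le> ent B i \<and> ent B i \<noteq> \<infinity>))"
  proof (rule sum.cong[OF refl])
    fix i
    show "of_bool (i \<in> qset A B) = (of_bool (ent A i < ent B i \<and> ent B i \<noteq> \<infinity>)
       - of_bool (ent A (Suc i) \<le> ent B i \<and> ent B i \<noteq> \<infinity>) :: int)"
      using ent_mono[OF assms(1), of i] ent_infinity_Suc[of A i] unfolding qset_def
      by (cases "ent A i"; cases "ent A (Suc i)"; cases "ent B i") auto
  qed
  finally show ?thesis .
qed

lemma qcount_self: "column m A \<Longrightarrow> qcount A A = 0"
  by (simp add: qcount_def qset_def)

text \<open>Of the right column, membership of \<open>i\<close> in \<open>qset\<close> reads only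
  row \<open>i\<close>, so an exchange inside a row permutes the two summands.\<close>

lemma qcount_splice_right:
  assumes "column m S" "column m T" "length T = Suc (length S)" "col_splice S T = (U, V)"
  shows "int (qcount C U) + int (qcount C V) = int (qcount C S) + int (qcount C T)"
proof -
  obtain k where k: "\<And>i. ent U i = (if i < k then ent S i else ent T i)"
    "\<And>i. ent V i = (if i < k then ent T i else ent S i)"
    using splice_cases[OF assms] by metis
  have l: "length U \<le> length T" "length V \<le> length T" "length S \<le> length T"
    using splice_inverse[OF assms] assms by auto
  have e: "int (qcount C X) = (\<Sum>i<length T. of_bool (i \<in> qset C X))" if "length X \<le> length T" for X
    unfolding qcount_def by (rule card_eq_sum_of_bool) (use qset_subset[of C X] that in fastforce)
  show ?thesis
    unfolding e[OF l(1)] e[OF l(2)] e[OF l(3)] e[OF order_refl] sum.distrib[symmetric]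
    by (rule sum.cong) (auto simp: qset_def k)
qed

text \<open>In the left argument consecutive rows are involved, and the seam may lie between them;
  \<open>qcount_expand\<close> allows each row to be exchanged on its own.\<close>

lemma qcount_splice_left:
  assumes "column m S" "column m T" "length T = Suc (length S)" "col_splice S T = (U, V)"
  shows "int (qcount U C) + int (qcount V C) = int (qcount S C) + int (qcount T C)"
proof -
  obtain k where k: "\<And>i. ent U i = (if i < k then ent S i else ent T i)"
    "\<And>i. ent V i = (if i < k then ent T i else ent S i)"
    using splice_cases[OF assms] by metis
  note c = splice_inverse(1,2)[OF assms]
  show ?thesis
    unfolding qcount_expand[OF c(1) order_refl] qcount_expand[OF c(2) order_refl]
      qcount_expand[OF assms(1) order_refl] qcount_expand[OF assms(2) order_refl]
      sum.distrib[symmetric]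
    by (rule sum.cong) (simp_all add: k)
qed

text \<open>The two sets of rows agree. From the cut on, \<open>ent T (Suc i) \<le> ent S i\<close>
  leaves no row in either set. In the row \<open>i = k - 1\<close>, strictness of \<open>T\<close>
  and \<open>ent T k \<le> ent S k\<close> make the upper bound automatic in both sets, and
  \<open>ent S i < ent T i\<close> decides.\<close>

lemma qcount_splice:
  assumes "column m S" "column m T" "length T = Suc (length S)" "col_splice S T = (U, V)"
  shows "qcount U V = qcount S T"
proof -
  obtain k where k: "splices_at k S T" "\<And>i. ent U i = (if i < k then ent S i else ent T i)"
    "\<And>i. ent V i = (if i < k then ent T i else ent S i)"
    using splice_cases[OF assms] by metis
  have hi: "ent T (Suc i) \<le> ent S i" if "k \<le> i" for i
    using that k(1) assms(3) by (auto simp: ent_def splices_at_def)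
  have "i \<in> qset U V \<longleftrightarrow> i \<in> qset S T" for i
  proof -
    consider "Suc i < k" | "Suc i = k" | "k \<le> i" by linarith
    then show ?thesis
    proof cases
      case 1 then show ?thesis by (simp add: qset_def k)
    next
      case 2
      have a: "ent T i < ent T (Suc i)"
        using k(1) 2 assms(3) column_nth_less[OF assms(2), of i "Suc i"]
        by (auto simp: ent_def splices_at_def)
      also have "ent T (Suc i) \<le> ent S (Suc i)"
        using hi[of "Suc i"] 2 ent_mono[OF assms(2), of "Suc i"]
        by (cases "ent T (Suc i) = \<infinity>") (auto simp: ent_def split: if_splits dest: order.strict_implies_order)
      finally show ?thesis using 2 a by (simp add: qset_def k)
    next
      case 3
      have "ent T i \<le> ent S i"
        using hi[OF 3] ent_mono[OF assms(2), of i] ent_infinity_Suc[of T i] by (cases "ent T i = \<infinity>") auto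
      then show ?thesis using hi[OF 3] 3 by (auto simp: qset_def k)
    qed
  qed
  then show ?thesis unfolding qcount_def by (metis subsetI subset_antisym)
qed

text \<open>The value \<open>m\<close> can only be the last entry of a column, so its deletion
  replaces one entry by infinity and moves nothing.\<close>

lemma ent_filter_max:
  assumes "column m A"
  shows "ent (filter (\<lambda>a. a \<noteq> m) A) i = (if ent A i = enat m then \<infinity> else ent A i)"
    and "column (m - 1) (filter (\<lambda>a. a \<noteq> m) A)"
    and "A = filter (\<lambda>a. a \<noteq> m) A @ (if m \<in> set A then [m] else [])"
proof -
  show *: "A = filter (\<lambda>a. a \<noteq> m) A @ (if m \<in> set A then [m] else [])"
    using assms
  proof (induction A rule: rev_induct)
    case (snoc x A)
    then have "\<forall>a\<in>set A. a < x" "x \<le> m" "column m A" by (auto simp: column_def sorted_wrt_append)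
    moreover from this have "\<forall>a\<in>set A. a \<noteq> m" by force
    ultimately show ?case by (cases "x = m") auto
  qed auto
  define B where "B = filter (\<lambda>a. a \<noteq> m) A"
  have m: "m \<notin> set B" by (simp add: B_def)
  show "ent (filter (\<lambda>a. a \<noteq> m) A) i = (if ent A i = enat m then \<infinity> else ent A i)"
    using * m unfolding B_def[symmetric] by (auto simp: ent_def nth_append split: if_splits)
  show "column (m - 1) (filter (\<lambda>a. a \<noteq> m) A)"
    using assms by (fastforce simp: column_def sorted_wrt_filter)
qed

text \<open>A finite entry of \<open>B\<close> other than \<open>m\<close> lies below
  \<open>m\<close> and below infinity, so it does not notice that an entry \<open>m\<close> of
  \<open>A\<close> becomes infinite. If \<open>ent B i = m\<close>, row \<open>i\<close> counts
  exactly when \<open>A\<close> has a smaller entry there and ends, and the deletion loses this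
  row.\<close>

lemma qcount_delete:
  assumes "column m A" "column m B"
  shows "qcount A B = qcount (filter (\<lambda>a. a \<noteq> m) A) (filter (\<lambda>a. a \<noteq> m) B) +
    of_bool (length A = length B \<and> m \<notin> set A \<and> m \<in> set B)"
proof -
  let ?A = "filter (\<lambda>a. a \<noteq> m) A" and ?B = "filter (\<lambda>a. a \<noteq> m) B"
  let ?P = "length A = length B \<and> m \<notin> set A \<and> m \<in> set B"
  note eA = ent_filter_max(1)[OF assms(1)] and eB = ent_filter_max(1)[OF assms(2)]
  have leA: "ent A i = \<infinity> \<or> ent A i \<le> enat m" and leB: "ent B i = \<infinity> \<or> ent B i \<le> enat m" for i
    using column_nth_bounds[OF assms(1), of i] column_nth_bounds[OF assms(2), of i]
    by (auto simp: ent_def)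
  have lastB: "B ! i = m \<longleftrightarrow> m \<in> set B \<and> Suc i = length B" if "i < length B" for i
  proof
    assume "B ! i = m"
    then show "m \<in> set B \<and> Suc i = length B"
      using that column_nth_less[OF assms(2), of i "Suc i"] column_nth_bounds[OF assms(2), of "Suc i"]
      by (cases "Suc i < length B") (auto simp: in_set_conv_nth)
  next
    assume a: "m \<in> set B \<and> Suc i = length B"
    show "B ! i = m"
      using ent_filter_max(3)[OF assms(2)] a
      by (metis diff_Suc_1 last_conv_nth last_snoc length_0_conv nat.distinct(1))
  qed
  \<comment> \<open>The second set is the bottom row of \<open>B\<close> when \<open>?P\<close>
    holds, and empty otherwise.\<close>
  have "qset A B = qset ?A ?B \<union> {i. ?P \<and> Suc i = length B}"
  proof (rule set_eqI)
    fix i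
    show "i \<in> qset A B \<longleftrightarrow> i \<in> qset ?A ?B \<union> {i. ?P \<and> Suc i = length B}"
    proof (cases "ent B i = enat m")
      case True
      then have iB: "i < length B" "m \<in> set B" "Suc i = length B"
        using lastB by (auto simp: ent_def split: if_splits)
      have "i \<notin> qset ?A ?B" by (simp add: qset_def eB True)
      moreover have "i \<in> qset A B \<longleftrightarrow> ent A i < enat m \<and> ent A (Suc i) = \<infinity>"
        using leA[of "Suc i"] True by (auto simp: qset_def)
      moreover have "\<dots> \<longleftrightarrow> length A = length B \<and> m \<notin> set A"
      proof
        assume a: "ent A i < enat m \<and> ent A (Suc i) = \<infinity>"
        then have l: "length A = Suc i" by (auto simp: ent_def split: if_splits)
        have "m \<notin> set A"
        proof
          assume "m \<in> set A"
          then obtain p where "p < length A" "A ! p = m" by (auto simp: in_set_conv_nth)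
          moreover have "A ! p \<le> A ! i" using l \<open>p < length A\<close> column_nth_less[OF assms(1), of p i]
            by (cases "p = i") auto
          ultimately show False using a l by (auto simp: ent_def)
        qed
        then show "length A = length B \<and> m \<notin> set A" using l iB by simp
      next
        assume a: "length A = length B \<and> m \<notin> set A"
        then have "A ! i \<noteq> m" using iB by (metis nth_mem)
        then show "ent A i < enat m \<and> ent A (Suc i) = \<infinity>"
          using a iB column_nth_bounds[OF assms(1), of i] by (simp add: ent_def)
      qed
      ultimately show ?thesis using iB by auto
    next
      case False
      then have "\<not> (m \<in> set B \<and> Suc i = length B)" using lastB[of i] by (auto simp: ent_def)
      moreover have "i \<in> qset A B \<longleftrightarrow> i \<in> qset ?A ?B"
        using leA[of i] leA[of "Suc i"] leB[of i] False unfolding qset_def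
        by (cases "ent A i"; cases "ent A (Suc i)"; cases "ent B i") (auto simp: eA eB)
      ultimately show ?thesis by auto
    qed
  qed
  moreover have "qset ?A ?B \<inter> {i. ?P \<and> Suc i = length B} = {}"
  proof -
    have "i \<notin> qset ?A ?B" if "m \<in> set B" "Suc i = length B" for i
    proof -
      have "ent B i = enat m" using that lastB[of i] by (auto simp: ent_def)
      then show ?thesis by (simp add: qset_def eB)
    qed
    then show ?thesis by auto
  qed
  moreover have "finite {i. ?P \<and> Suc i = length B}"
    by (rule finite_subset[of _ "{..length B}"]) auto
  ultimately have "qcount A B = qcount ?A ?B + card {i. ?P \<and> Suc i = length B}"
    unfolding qcount_def by (simp add: card_Un_disjoint)
  moreover have "card {i. ?P \<and> Suc i = length B} = of_bool ?P"
  proof (cases ?P)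
    case True
    then have "{i. ?P \<and> Suc i = length B} = {length B - 1}" by (cases B) auto
    then show ?thesis using True by simp
  qed auto
  ultimately show ?thesis by simp
qed


section \<open>Sequences of splices\<close>

definition col_system :: "nat \<Rightarrow> nat list \<Rightarrow> nat list list \<Rightarrow> bool" where
  "col_system m c C \<longleftrightarrow> sorted_wrt (\<ge>) c \<and>
     list_all2 (\<lambda>l A. length A \<le> l \<and> l \<le> Suc (length A) \<and> column m A) c C"

text \<open>With \<open>x\<close> and \<open>y\<close> the entries of \<open>c\<close> at
  \<open>S\<close> and \<open>T\<close>, one has
  \<open>length T \<le> y \<le> x \<le> Suc (length S)\<close>; together with
  \<open>length S < length T\<close> all of these are equalities. That \<open>x = y\<close> is what
  allows the two lengths to be interchanged without leaving the system.\<close>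

lemma col_systemD:
  assumes "col_system m c (P @ S # T # R)" "length S < length T"
  shows "column m S" "column m T" "length T = Suc (length S)"
    "\<exists>p r. c = p @ length T # length T # r \<and> length p = length P"
proof -
  obtain p l where c: "c = p @ l" "length p = length P"
    and l: "list_all2 (\<lambda>l A. length A \<le> l \<and> l \<le> Suc (length A) \<and> column m A) l (S # T # R)"
    using assms(1) by (auto simp: col_system_def list_all2_append2)
  then obtain x y r where lr: "l = x # y # r" by (auto simp: list_all2_Cons2)
  have "x \<ge> y" using assms(1) by (auto simp: col_system_def c lr sorted_wrt_append)
  then have "x = length T" "y = length T" "length T = Suc (length S)" "column m S" "column m T"
    using l assms(2) by (auto simp: lr)
  then show "column m S" "column m T" "length T = Suc (length S)"
    "\<exists>p r. c = p @ length T # length T # r \<and> length p = length P" using c lr by auto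
qed

lemma splice_stepI:
  "length S < length T \<Longrightarrow> col_splice S T = (U, V) \<Longrightarrow>
    splice_step (P @ S # T # R) (P @ U # V # R)"
  using splice_step.intros[of "length P" "P @ S # T # R" U V]
  by (simp add: nth_append list_update_append)

lemma splice_stepE:
  assumes "splice_step C D"
  obtains P S T R U V where "C = P @ S # T # R" "D = P @ U # V # R" "length S < length T"
    "col_splice S T = (U, V)"
  using assms
proof cases
  case (1 j s t)
  have C: "C = take j C @ C ! j # C ! Suc j # drop (Suc (Suc j)) C"
    using 1(2) by (metis Cons_nth_drop_Suc Suc_lessD id_take_nth_drop)
  have l: "length (take j C) = j" using 1(2) by simp
  have "D = take j C @ s # t # drop (Suc (Suc j)) C"
    unfolding 1(1) by (subst C) (use l in \<open>simp add: list_update_append split: nat.splits\<close>)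
  then show ?thesis using that C 1 by blast
qed

lemma splice_step_col_system:
  assumes "col_system m c C" "splice_step C D"
  shows "col_system m c D"
  using assms(2)
proof (rule splice_stepE)
  fix P S T R U V
  assume e: "C = P @ S # T # R" "D = P @ U # V # R" and l: "length S < length T"
    and s: "col_splice S T = (U, V)"
  note d = col_systemD[OF assms(1)[unfolded e] l]
  note i = splice_inverse[OF d(1,2,3) s]
  show ?thesis using assms(1) d(3,4) i by (auto simp: col_system_def e list_all2_append)
qed

lemma splice_steps_col_system:
  "splice_step\<^sup>*\<^sup>* C D \<Longrightarrow> col_system m c C \<Longrightarrow> col_system m c D"
  by (induction rule: rtranclp_induct) (auto intro: splice_step_col_system)

lemma splice_step_diamond:
  assumes "col_system m c C" "splice_step C X" "splice_step C Y"
  shows "X = Y \<or> (\<exists>Z. splice_step X Z \<and> splice_step Y Z)"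
proof -
  have cl: "length c = length C" "\<And>i. i < length C \<Longrightarrow> length (C ! i) \<le> c ! i \<and> c ! i \<le> Suc (length (C ! i))"
    using assms(1) by (auto simp: col_system_def list_all2_conv_all_nth)
  have cs: "c ! Suc i \<le> c ! i" if "Suc i < length C" for i
    using assms(1) that cl by (auto simp: col_system_def sorted_wrt_iff_nth_less)
  \<comment> \<open>Overlapping applicable places would make the lengths rise twice within three
    columns, but the lengths stay within one of the weakly decreasing \<open>c\<close>.\<close>
  have far: "j' \<noteq> Suc j" if "Suc j < length C" "length (C ! j) < length (C ! Suc j)"
    "Suc j' < length C" "length (C ! j') < length (C ! Suc j')" for j j'
  proof
    assume "j' = Suc j"
    then show False using that cl(2)[of j] cl(2)[of "Suc (Suc j)"] cs[of j] cs[of "Suc j"] by auto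
  qed
  from assms(2) show ?thesis
  proof cases
    case j: (1 j s t)
    from assms(3) show ?thesis
    proof cases
      case j': (1 j' s' t')
      consider "j = j'" | "Suc j < j'" | "Suc j' < j" using far[of j j'] far[of j' j] j(2,3) j'(2,3) by linarith
      then show ?thesis
      proof cases
        case 1 then show ?thesis using j j' by auto
      next
        case 2
        have "splice_step X (X[j' := s', Suc j' := t'])"
          by (rule splice_step.intros) (use j j' 2 in auto)
        moreover have "splice_step Y (Y[j := s, Suc j := t])"
          by (rule splice_step.intros) (use j j' 2 in auto)
        moreover have "X[j' := s', Suc j' := t'] = Y[j := s, Suc j := t]"
          unfolding j j' by (subst list_eq_iff_nth_eq) (use 2 j(2) j'(2) in \<open>auto simp: nth_list_update\<close>)
        ultimately show ?thesis by metis
      next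
        case 3
        have "splice_step X (X[j' := s', Suc j' := t'])"
          by (rule splice_step.intros) (use j j' 3 in auto)
        moreover have "splice_step Y (Y[j := s, Suc j := t])"
          by (rule splice_step.intros) (use j j' 3 in auto)
        moreover have "X[j' := s', Suc j' := t'] = Y[j := s, Suc j := t]"
          unfolding j j' by (subst list_eq_iff_nth_eq) (use 3 j(2) j'(2) in \<open>auto simp: nth_list_update\<close>)
        ultimately show ?thesis by metis
      qed
    qed
  qed
qed

text \<open>The sum of the entries, each multiplied by its position counted from 0. A splice moves
  the longer column to the left and so decreases it; it is the measure for the inductions along
  splice sequences.\<close>

fun pos_weight :: "nat list \<Rightarrow> nat" where
  "pos_weight [] = 0"
| "pos_weight (x # xs) = sum_list xs + pos_weight xs"

lemma pos_weight_swap: "a < b \<Longrightarrow> pos_weight (P @ b # a # R) < pos_weight (P @ a # b # R)"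
  by (induction P) auto

lemma pos_weight_splice_step:
  assumes "col_system m c C" "splice_step C D"
  shows "pos_weight (map length D) < pos_weight (map length C)"
  using assms(2)
proof (rule splice_stepE)
  fix P S T R U V
  assume e: "C = P @ S # T # R" "D = P @ U # V # R" and l: "length S < length T"
    and s: "col_splice S T = (U, V)"
  note d = col_systemD[OF assms(1)[unfolded e] l]
  note i = splice_inverse[OF d(1,2,3) s]
  show ?thesis using i d(3) pos_weight_swap[OF l] by (simp add: e)
qed

section \<open>Final column lists: existence, uniqueness and reversal\<close>

lemma unsorted_adjacent:
  "\<not> sorted_wrt (\<ge>) (h :: nat list) \<Longrightarrow> \<exists>P a b R. h = P @ a # b # R \<and> a < b"
proof (induction h)
  case (Cons x h)
  show ?case
  proof (cases "sorted_wrt (\<ge>) h")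
    case True
    then obtain b R where "h = b # R" "x < b"
      using Cons.prems by (cases h) (fastforce simp: not_le dest: le_less_trans less_le_trans)+
    then show ?thesis by (metis append_Nil)
  next
    case False
    then show ?thesis using Cons.IH by (metis append_Cons)
  qed
qed simp

lemma map_eq_append_Cons2:
  assumes "map f xs = p @ a # b # r"
  obtains P S T R where "xs = P @ S # T # R" "map f P = p" "f S = a" "f T = b" "map f R = r"
  using assms by (auto simp: map_eq_append_conv map_eq_Cons_conv)

lemma not_partition_shaped_step:
  assumes "\<not> partition_shaped C"
  shows "\<exists>D. splice_step C D"
proof -
  obtain P a b R where "map length C = P @ a # b # R" "a < b"
    using unsorted_adjacent assms unfolding partition_shaped_def by blast
  then obtain P S T R where "C = P @ S # T # R" "length S < length T"
    by (elim map_eq_append_Cons2) auto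
  then show ?thesis using splice_stepI[of S T] by (metis surj_pair)
qed

lemma partition_shaped_no_step: "partition_shaped C \<Longrightarrow> \<not> splice_step C D"
  by (force simp: partition_shaped_def sorted_wrt_append elim!: splice_stepE)

lemma splice_normal_form:
  assumes "col_system m c C"
  shows "\<exists>D. splice_step\<^sup>*\<^sup>* C D \<and> partition_shaped D"
  using assms
proof (induction "pos_weight (map length C)" arbitrary: C rule: less_induct)
  case less
  show ?case
  proof (cases "partition_shaped C")
    case False
    then obtain X where X: "splice_step C X" using not_partition_shaped_step by blast
    then show ?thesis
      using less.hyps[OF pos_weight_splice_step[OF less.prems X] splice_step_col_system[OF less.prems X]]
      by (meson converse_rtranclp_into_rtranclp)
  qed auto
qed

text \<open>Newman's argument along \<open>pos_weight\<close>: different first steps of the two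
  sequences are joined in \<open>Z\<close>, and a final list \<open>E\<close> below \<open>Z\<close>
  is reached from both sides, so the induction hypotheses at \<open>X\<close> and \<open>Y\<close>
  identify \<open>D\<close> and \<open>D'\<close> with \<open>E\<close>.\<close>

lemma splice_normal_form_unique:
  assumes "col_system m c C" "splice_step\<^sup>*\<^sup>* C D" "partition_shaped D"
    "splice_step\<^sup>*\<^sup>* C D'" "partition_shaped D'"
  shows "D = D'"
  using assms
proof (induction "pos_weight (map length C)" arbitrary: C D D' rule: less_induct)
  case less
  note IH = less.hyps[OF pos_weight_splice_step[OF less.prems(1)] splice_step_col_system[OF less.prems(1)]]
  show ?case
  proof (cases "partition_shaped C")
    case True
    then show ?thesis using less.prems partition_shaped_no_step by (metis converse_rtranclpE)
  next
    case False
    then obtain X Y where X: "splice_step C X" "splice_step\<^sup>*\<^sup>* X D"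
      and Y: "splice_step C Y" "splice_step\<^sup>*\<^sup>* Y D'"
      using less.prems by (metis converse_rtranclpE)
    show ?thesis
    proof (cases "X = Y")
      case True then show ?thesis using IH[OF X(1) X(1) X(2)] Y less.prems by blast
    next
      case False
      then obtain Z where Z: "splice_step X Z" "splice_step Y Z"
        using splice_step_diamond[OF less.prems(1) X(1) Y(1)] by blast
      obtain E where E: "splice_step\<^sup>*\<^sup>* Z E" "partition_shaped E"
        using splice_normal_form[OF splice_step_col_system[OF splice_step_col_system[OF less.prems(1) X(1)] Z(1)]]
        by blast
      have "D = E" using IH[OF X(1) X(1) X(2)] less.prems E Z
        by (meson converse_rtranclp_into_rtranclp)
      moreover have "D' = E" using IH[OF Y(1) Y(1) Y(2)] less.prems E Z
        by (meson converse_rtranclp_into_rtranclp)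
      ultimately show ?thesis by simp
    qed
  qed
qed

text \<open>With equal lengths, a splice applicable in \<open>C\<close> applies to \<open>C'\<close>
  at the same place, and the results have equal lengths again. The induction hypothesis identifies
  the results, and \<open>splice_inverse\<close> recovers the spliced pairs from them.\<close>

lemma splice_step_injective:
  assumes "col_system m c C" "col_system m c C'" "map length C = map length C'"
    "splice_step\<^sup>*\<^sup>* C D" "splice_step\<^sup>*\<^sup>* C' D" "partition_shaped D"
  shows "C = C'"
  using assms
proof (induction "pos_weight (map length C)" arbitrary: C C' rule: less_induct)
  case less
  show ?case
  proof (cases "partition_shaped C")
    case True
    moreover then have "partition_shaped C'" using less.prems by (simp add: partition_shaped_def)
    ultimately show ?thesis using less.prems partition_shaped_no_step by (metis converse_rtranclpE)
  next
    case False
    then obtain X where X: "splice_step C X" "splice_step\<^sup>*\<^sup>* X D"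
      using less.prems by (metis converse_rtranclpE)
    obtain P S T R U V where e: "C = P @ S # T # R" "X = P @ U # V # R" and l: "length S < length T"
      and s: "col_splice S T = (U, V)" using X(1) by (rule splice_stepE)
    have "map length C' = map length P @ length S # length T # map length R"
      using less.prems(3)[symmetric] by (simp add: e)
    then obtain P' S' T' R' where e': "C' = P' @ S' # T' # R'" "map length P' = map length P"
      "length S' = length S" "length T' = length T" "map length R' = map length R"
      by (rule map_eq_append_Cons2)
    obtain U' V' where s': "col_splice S' T' = (U', V')" by fastforce
    have l': "length S' < length T'" using e' l by simp
    let ?X = "P' @ U' # V' # R'"
    have X': "splice_step C' ?X" unfolding e' by (rule splice_stepI[OF l' s'])
    note d = col_systemD[OF less.prems(1)[unfolded e] l]
    note d' = col_systemD[OF less.prems(2)[unfolded e'] l']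
    note i = splice_inverse[OF d(1,2,3) s]
    note i' = splice_inverse[OF d'(1,2,3) s']
    obtain E where E: "splice_step\<^sup>*\<^sup>* ?X E" "partition_shaped E"
      using splice_normal_form[OF splice_step_col_system[OF less.prems(2) X']] by blast
    \<comment> \<open>The step copied into \<open>C'\<close> need not begin the given sequence from
      \<open>C'\<close>; uniqueness of the final list shows that it leads to \<open>D\<close> all
      the same.\<close>
    have "E = D"
      using splice_normal_form_unique[OF less.prems(2) _ E(2) less.prems(5,6)] E(1) X'
      by (meson converse_rtranclp_into_rtranclp)
    then have "X = ?X"
      using less.hyps[OF pos_weight_splice_step[OF less.prems(1) X(1)]
          splice_step_col_system[OF less.prems(1) X(1)] splice_step_col_system[OF less.prems(2) X'] _ X(2)]
        E less.prems(6) e' i i' by (simp add: e)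
    moreover have "length P = length P'" using e'(2) map_eq_imp_length_eq by metis
    ultimately have "P = P'" "U = U'" "V = V'" "R = R'" by (auto simp: e)
    then show ?thesis using i(5) i'(5) by (simp add: e e')
  qed
qed

text \<open>Splices are undone starting from \<open>D\<close>. If \<open>h\<close> has an ascent
  \<open>a < b\<close>, the list with these two interchanged has smaller \<open>pos_weight\<close>
  and is realised by induction; undoing one splice at that place restores the order. A weakly
  decreasing \<open>h\<close> already equals \<open>map length D\<close>, as the multisets
  agree.\<close>

lemma splice_step_surjective:
  assumes "sorted_wrt (\<ge>) c" "list_all2 (\<lambda>l x. x \<le> l \<and> l \<le> Suc x) c h"
    "col_system m c D" "partition_shaped D" "mset h = mset (map length D)"
  shows "\<exists>C. col_system m c C \<and> map length C = h \<and> splice_step\<^sup>*\<^sup>* C D"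
  using assms
proof (induction "pos_weight h" arbitrary: h rule: less_induct)
  case less
  show ?case
  proof (cases "sorted_wrt (\<ge>) h")
    case True
    then have "sorted (rev h)" "sorted (rev (map length D))"
      using less.prems(4) by (simp_all add: partition_shaped_def sorted_wrt_rev)
    moreover have "mset (rev h) = mset (rev (map length D))" using less.prems(5) by simp
    ultimately have "rev h = rev (map length D)" by (metis properties_for_sort sorted_sort_id)
    then show ?thesis using less.prems(3) by auto
  next
    case False
    then obtain p a b r where h: "h = p @ a # b # r" "a < b" using unsorted_adjacent by blast
    have "\<exists>c1 x y c2. c = c1 @ x # y # c2 \<and>
        list_all2 (\<lambda>l x. x \<le> l \<and> l \<le> Suc x) c1 p \<and> a \<le> x \<and> x \<le> Suc a \<and> b \<le> y \<and> y \<le> Suc b \<and>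
        list_all2 (\<lambda>l x. x \<le> l \<and> l \<le> Suc x) c2 r"
      using less.prems(2) unfolding h by (auto simp: list_all2_append2 list_all2_Cons2)
    then obtain c1 x y c2 where c: "c = c1 @ x # y # c2"
        "list_all2 (\<lambda>l x. x \<le> l \<and> l \<le> Suc x) c1 p" "a \<le> x" "x \<le> Suc a" "b \<le> y" "y \<le> Suc b"
        "list_all2 (\<lambda>l x. x \<le> l \<and> l \<le> Suc x) c2 r" by blast
    have xy: "y \<le> x" using less.prems(1) by (auto simp: c sorted_wrt_append)
    have "list_all2 (\<lambda>l x. x \<le> l \<and> l \<le> Suc x) c (p @ b # a # r)"
      using c xy h(2) by (auto intro!: list_all2_appendI)
    moreover have "mset (p @ b # a # r) = mset (map length D)" using less.prems(5) h by (simp add: add_mset_commute)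
    ultimately obtain C where C: "col_system m c C" "map length C = p @ b # a # r" "splice_step\<^sup>*\<^sup>* C D"
      using less.hyps[of "p @ b # a # r"] less.prems pos_weight_swap[OF h(2)] unfolding h by blast
    from C(2) obtain P U V R where e: "C = P @ U # V # R" "map length P = p" "length U = b" "length V = a"
      "map length R = r" by (rule map_eq_append_Cons2)
    have pl: "length c1 = length P" using c(2) e(2) list_all2_lengthD by fastforce
    have ba: "b = Suc a" using c xy h(2) by simp
    have UV: "column m U" "column m V"
      using C(1) pl by (auto simp: col_system_def e(1) c(1) list_all2_append)
    \<comment> \<open>In \<open>C\<close> the longer column \<open>U\<close> is on the left.
      Splicing the exchanged pair gives the columns whose splice is \<open>(U, V)\<close>.\<close>
    obtain T S where s: "col_splice V U = (T, S)" by fastforce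
    note i = splice_inverse[OF UV(2,1) _ s]
    have i': "column m T" "column m S" "length T = Suc (length S)" "length S = length V" "col_splice S T = (U, V)"
      using i e ba by auto
    let ?C = "P @ S # T # R"
    have "splice_step ?C C" unfolding e by (rule splice_stepI) (use i' in auto)
    moreover have "col_system m c ?C"
      using C(1) i' e(3,4) ba c(3-6) xy pl
      by (auto simp: col_system_def e(1) c(1) list_all2_append)
    moreover have "map length ?C = h" using e i' ba h by simp
    ultimately show ?thesis using C(3) converse_rtranclp_into_rtranclp[of splice_step ?C C D] by blast
  qed
qed


section \<open>Invariants of splicing\<close>

fun qtotal :: "nat list list \<Rightarrow> nat" where
  "qtotal [] = 0"
| "qtotal (A # C) = (\<Sum>B\<leftarrow>C. qcount A B) + qtotal C"

lemma qtotal_append: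
  "qtotal (C @ D) = qtotal C + qtotal D + (\<Sum>A\<leftarrow>C. \<Sum>B\<leftarrow>D. qcount A B)"
  by (induction C) auto

lemma qtotal_sum:
  "qtotal C = (\<Sum>b<length C. \<Sum>a<b. qcount (C ! a) (C ! b))"
proof (induction C rule: rev_induct)
  case (snoc B C)
  have "(\<Sum>A\<leftarrow>C. qcount A B) = (\<Sum>a<length C. qcount (C ! a) B)"
    by (simp add: sum_list_sum_nth atLeast0LessThan)
  then show ?case using snoc by (simp add: qtotal_append nth_append)
qed simp

text \<open>Rows are counted from 0, so this becomes entry \<open>(Suc i, j)\<close> of the pattern;
  a missing cell has entry infinity and does not count.\<close>

definition row_count :: "nat \<Rightarrow> nat \<Rightarrow> nat list list \<Rightarrow> nat" where
  "row_count i j C = length (filter (\<lambda>A. ent A i \<le> enat j) C)"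

text \<open>For \<open>qtotal\<close>, the spliced pair itself is unchanged by
  \<open>qcount_splice\<close>, and a column outside it sees the two spliced columns only through a
  sum of two terms. Row counts persist because entries are exchanged inside rows.\<close>

lemma splice_step_invariants:
  assumes "col_system m c C" "splice_step C D"
  shows "qtotal D = qtotal C" "row_count i j D = row_count i j C"
    "mset (map length D) = mset (map length C)"
proof -
  obtain P S T R U V where e: "C = P @ S # T # R" "D = P @ U # V # R" and l: "length S < length T"
    and s: "col_splice S T = (U, V)" using assms(2) by (rule splice_stepE)
  note d = col_systemD[OF assms(1)[unfolded e] l]
  note i = splice_inverse[OF d(1,2,3) s]
  obtain k where k: "\<And>i. ent U i = (if i < k then ent S i else ent T i)"
    "\<And>i. ent V i = (if i < k then ent T i else ent S i)"
    using splice_cases[OF d(1,2,3) s] by metis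
  show "mset (map length D) = mset (map length C)" using i d(3) by (simp add: e)
  show "row_count i j D = row_count i j C" by (simp add: e row_count_def k)
  have "(\<Sum>A\<leftarrow>P. qcount A U + qcount A V) = (\<Sum>A\<leftarrow>P. qcount A S + qcount A T)"
    using qcount_splice_right[OF d(1,2,3) s] by (metis of_nat_add of_nat_eq_iff)
  moreover have "(\<Sum>B\<leftarrow>R. qcount U B + qcount V B) = (\<Sum>B\<leftarrow>R. qcount S B + qcount T B)"
    using qcount_splice_left[OF d(1,2,3) s] by (metis of_nat_add of_nat_eq_iff)
  ultimately show "qtotal D = qtotal C"
    using qcount_splice[OF d(1,2,3) s] by (simp add: e qtotal_append sum_list_addf)
qed

lemma splice_steps_invariants:
  assumes "splice_step\<^sup>*\<^sup>* C D" "col_system m c C"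
  shows "qtotal D = qtotal C" "row_count i j D = row_count i j C"
    "mset (map length D) = mset (map length C)"
proof -
  have "qtotal D = qtotal C \<and> row_count i j D = row_count i j C \<and>
    mset (map length D) = mset (map length C)"
    using assms
  proof (induction rule: rtranclp_induct)
    case (step Y Z)
    then show ?case
      using splice_step_invariants[OF splice_steps_col_system[OF step(1,4)] step(2)] by metis
  qed simp
  then show "qtotal D = qtotal C" "row_count i j D = row_count i j C"
    "mset (map length D) = mset (map length C)" by auto
qed


section \<open>Words and partitions in a rectangle\<close>

text \<open>Each \<open>True\<close> contributes the number of letters \<open>False\<close> before
  it, listed from the last \<open>True\<close> to the first. This is the partition bounded by the
  lattice path of the word, and its size is the number of pairs of a \<open>False\<close> before a
  \<open>True\<close>.\<close>

fun word_part :: "bool list \<Rightarrow> nat list" where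
  "word_part [] = []"
| "word_part (b # w) = (if b then word_part w @ [0] else map Suc (word_part w))"

lemma length_word_part: "length (word_part w) = length (filter id w)"
  by (induction w) auto

lemma sum_list_word_part_Cons:
  "sum_list (word_part (b # w)) = sum_list (word_part w) + (if b then 0 else length (filter id w))"
proof -
  have "sum_list (map Suc xs) = sum_list xs + length xs" for xs by (induction xs) auto
  then show ?thesis by (simp add: length_word_part)
qed

lemma word_part_fits:
  "word_part w \<in> fits (length (filter id w)) (length (filter Not w))"
proof -
  have "sorted_wrt (\<ge>) (word_part w) \<and> (\<forall>p\<in>set (word_part w). p \<le> length (filter Not w))"
    by (induction w) (auto simp: sorted_wrt_append sorted_wrt_map)
  then show ?thesis by (simp add: fits_def length_word_part)
qed

text \<open>The first letter is \<open>True\<close> exactly when the partition ends in 0, since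
  \<open>map Suc\<close> produces no 0. Trailing letters \<open>False\<close> leave no trace, hence
  the condition on the lengths.\<close>

lemma word_part_inj: "length w = length w' \<Longrightarrow> word_part w = word_part w' \<Longrightarrow> w = w'"
proof (induction w w' rule: list_induct2)
  case (Cons b w b' w')
  have "xs @ [0] \<noteq> map Suc ys" for xs ys :: "nat list"
    by (metis Zero_not_Suc ex_map_conv in_set_conv_decomp)
  then have "b = b'" using Cons.prems by (auto split: if_splits) metis+
  then show ?case using Cons by (auto split: if_splits simp: inj_map_eq_map)
qed simp

text \<open>The first letter is read off the smallest part: a last part 0 is removed and gives
  \<open>True\<close>; otherwise all parts are positive, are lowered by one, and the letter is
  \<open>False\<close>.\<close>

lemma word_part_surj:
  "g \<in> fits k l \<Longrightarrow> \<exists>w. word_part w = g \<and> length (filter id w) = k \<and> length (filter Not w) = l"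
proof (induction "k + l" arbitrary: g k l)
  case 0
  then show ?case by (intro exI[of _ "[]"]) (auto simp: fits_def)
next
  case (Suc N)
  show ?case
  proof (cases "\<exists>g'. g = g' @ [0]")
    case True
    then obtain g' where g: "g = g' @ [0]" by blast
    then have "g' \<in> fits (k - 1) l" "k > 0" using Suc.prems by (auto simp: fits_def sorted_wrt_append)
    then obtain w where "word_part w = g' \<and> length (filter id w) = k - 1 \<and> length (filter Not w) = l"
      using Suc.hyps(1)[of "k - 1" l g'] Suc.hyps(2) by fastforce
    then show ?thesis using g \<open>k > 0\<close> by (intro exI[of _ "True # w"]) auto
  next
    case False
    have pos: "p > 0" if "p \<in> set g" for p
    proof (rule ccontr)
      assume "\<not> p > 0"
      then have "0 \<in> set g" using that by simp
      then have "g \<noteq> []" by auto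
      then have s: "g = butlast g @ [last g]" by simp
      then have "\<forall>q\<in>set (butlast g). last g \<le> q"
        using Suc.prems unfolding fits_def by (metis (mono_tags, lifting) mem_Collect_eq list.set_intros(1) sorted_wrt_append)
      then have "last g = 0" using \<open>0 \<in> set g\<close> s by (metis Un_iff bot_nat_0.extremum_uniqueI empty_iff empty_set set_ConsD set_append)
      then show False using False s by metis
    qed
    have "l > 0"
    proof (rule ccontr)
      assume "\<not> l > 0"
      then have "k > 0" using Suc.hyps(2) by simp
      then show False using Suc.prems pos \<open>\<not> l > 0\<close> by (cases g) (auto simp: fits_def)
    qed
    define g' where "g' = map (\<lambda>p. p - 1) g"
    have gg: "g = map Suc g'" using pos by (auto simp: g'_def map_idI)
    then have "g' \<in> fits k (l - 1)" using Suc.prems by (auto simp: fits_def sorted_wrt_map)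
    then obtain w where "word_part w = g' \<and> length (filter id w) = k \<and> length (filter Not w) = l - 1"
      using Suc.hyps(1)[of k "l - 1" g'] Suc.hyps(2) \<open>l > 0\<close> by fastforce
    then show ?thesis using gg \<open>l > 0\<close> by (intro exI[of _ "False # w"]) auto
  qed
qed


section \<open>Deleting the maximal entry\<close>

abbreviation del :: "nat \<Rightarrow> nat list \<Rightarrow> nat list" where
  "del n \<equiv> filter (\<lambda>a. a \<noteq> n)"

definition word :: "nat \<Rightarrow> nat \<Rightarrow> nat list list \<Rightarrow> bool list" where
  "word n i C = map (\<lambda>A. n \<in> set A) (filter (\<lambda>A. length A = i) C)"

lemma word_Nil: "word n i [] = []" by (simp add: word_def)

lemma word_Cons: "word n i (A # C) = (if length A = i then (n \<in> set A) # word n i C else word n i C)"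
  by (simp add: word_def)

lemma length_filter_word:
  "length (filter id (word n i C)) = length (filter (\<lambda>A. length A = i \<and> n \<in> set A) C)"
  "length (filter Not (word n i C)) = length (filter (\<lambda>A. length A = i \<and> n \<notin> set A) C)"
  by (induction C) (auto simp: word_Nil word_Cons)

lemma full_column_max: "column n A \<Longrightarrow> length A = n \<Longrightarrow> n > 0 \<Longrightarrow> n \<in> set A"
  using column_nth_ge[of n A "n - 1"] column_nth_bounds[of n A "n - 1"]
  by (metis One_nat_def Suc_pred diff_less le_antisym nth_mem zero_less_one)

text \<open>Adding \<open>A\<close> in front puts one letter in front of the word with index
  \<open>length A\<close>. If it is \<open>False\<close>, it precedes every \<open>True\<close> of
  that word, and these are the columns for which \<open>qcount_delete\<close> has its extra
  term.\<close>

lemma qtotal_delete: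
  assumes "\<forall>A\<in>set C. column n A"
  shows "qtotal C = qtotal (map (del n) C) + (\<Sum>i\<le>n. sum_list (word_part (word n i C)))"
  using assms
proof (induction C)
  case (Cons A C)
  let ?X = "length (filter (\<lambda>B. length A = length B \<and> n \<notin> set A \<and> n \<in> set B) C)"
  have 1: "(\<Sum>B\<leftarrow>C. qcount A B) = (\<Sum>B\<leftarrow>C. qcount (del n A) (del n B)) + ?X"
    using Cons.prems
  proof (induction C)
    case (Cons B C)
    then show ?case using qcount_delete[of n A B] by auto
  qed simp
  have A: "length A \<le> n" using Cons.prems column_length by auto
  have "sum_list (word_part (word n i (A # C))) = sum_list (word_part (word n i C)) +
     (if i = length A then ?X else 0)" for i
  proof (cases "i = length A")
    case True
    have "(\<lambda>B. length A = length B \<and> n \<in> set B) = (\<lambda>B. length B = length A \<and> n \<in> set B)" by auto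
    then show ?thesis using True
      by (simp add: word_Cons sum_list_word_part_Cons length_filter_word del: word_part.simps(2))
  qed (auto simp: word_Cons)
  then have "(\<Sum>i\<le>n. sum_list (word_part (word n i (A # C)))) =
      (\<Sum>i\<le>n. sum_list (word_part (word n i C))) + ?X"
    using A by (simp add: sum.distrib)
  then show ?case using 1 Cons by (simp add: o_def)
qed (simp add: word_Nil)

text \<open>An empty column lacks \<open>n\<close> and a column of length \<open>n\<close> contains
  it, so these words are constant. The remaining indices are those of the overlay partitions in row
  \<open>n - 1\<close>.\<close>

lemma sum_list_word_part_full:
  assumes "\<forall>A\<in>set C. column n A" "i = 0 \<or> i = n"
  shows "sum_list (word_part (word n i C)) = 0"
proof -
  have "(\<forall>b\<in>set w. \<not> b) \<or> (\<forall>b\<in>set w. b) \<Longrightarrow> sum_list (word_part w) = 0" for w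
  proof (induction w)
    case (Cons b w)
    then show ?case by (cases "b") (auto simp: sum_list_word_part_Cons filter_empty_conv simp del: word_part.simps(2))
  qed simp
  moreover have "(\<forall>b\<in>set (word n i C). \<not> b) \<or> (\<forall>b\<in>set (word n i C). b)"
    using assms full_column_max[of n] by (cases "i = 0") (auto simp: word_def)
  ultimately show ?thesis by blast
qed

lemma row_count_delete:
  assumes "\<forall>A\<in>set C. column n A" "j < n"
  shows "row_count i j (map (del n) C) = row_count i j C"
  using assms(1) by (induction C) (use assms(2) in \<open>auto simp: row_count_def ent_filter_max(1)\<close>)

lemma word_determines:
  assumes "map length C = map length C'" "\<And>i. word n i C = word n i C'"
  shows "map (\<lambda>A. n \<in> set A) C = map (\<lambda>A. n \<in> set A) C'"
proof -
  have "length C = length C'" using assms(1) map_eq_imp_length_eq by blast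
  then show ?thesis using assms
  proof (induction C C' rule: list_induct2)
    case (Cons A C A' C')
    have *: "length A = length A'" using Cons.prems by simp
    have "(n \<in> set A) = (n \<in> set A')"
      using Cons.prems(2)[of "length A"] * by (auto simp: word_Cons)
    moreover have "word n i C = word n i C'" for i
      using Cons.prems(2)[of i] * by (auto simp: word_Cons split: if_splits)
    ultimately show ?case using Cons by auto
  qed simp
qed

text \<open>Each position of \<open>c\<close> takes the next letter of the word belonging to its
  value; by the assumption on the lengths every word is used up exactly at the end.\<close>

lemma word_realize:
  assumes "\<And>i. length (w i) = length (filter (\<lambda>l. l = i) c)"
  shows "\<exists>bs. length bs = length c \<and> (\<forall>i. map snd (filter (\<lambda>x. fst x = i) (zip c bs)) = w i)"
  using assms
proof (induction c arbitrary: w)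
  case (Cons l c)
  obtain b u where lu: "w l = b # u" using Cons.prems[of l] by (cases "w l") auto
  have "length ((w(l := u)) i) = length (filter (\<lambda>l. l = i) c)" for i
    using Cons.prems[of i] lu by (auto split: if_splits)
  then obtain bs where "length bs = length c"
    "\<forall>i. map snd (filter (\<lambda>x. fst x = i) (zip c bs)) = (w(l := u)) i"
    using Cons.IH[of "w(l := u)"] by blast
  then show ?case using lu by (intro exI[of _ "b # bs"]) auto
qed simp


section \<open>Fillings as lists of columns\<close>

definition tableau_columns :: "nat \<Rightarrow> nat list list \<Rightarrow> bool" where
  "tableau_columns m D \<longleftrightarrow> partition_shaped D \<and> (\<forall>A\<in>set D. column m A)"

lemma tableau_columns_col_system:
  "col_system m c D \<Longrightarrow> partition_shaped D \<Longrightarrow> tableau_columns m D"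
  by (auto simp: tableau_columns_def col_system_def list_all2_conv_all_nth in_set_conv_nth)

lemma partitions_antimono:
  assumes "mu \<in> partitions m" "1 \<le> i" "i \<le> k" "k \<le> m"
  shows "mu k \<le> mu i"
  using assms(3,4)
proof (induction k rule: dec_induct)
  case (step k)
  then have "mu (Suc k) \<le> mu k" using assms(1,2) by (auto simp: partitions_def)
  then show ?case using step by simp
qed simp

text \<open>Row and column lengths are defined as cardinalities. For an initial segment, membership
  is comparison with the cardinality, which turns these lengths into statements about single
  cells.\<close>

lemma downset_eq_lessThan_card:
  assumes "finite (H :: nat set)" "\<And>i j. j \<in> H \<Longrightarrow> i < j \<Longrightarrow> i \<in> H"
  shows "H = {..<card H}"
proof (cases "H = {}")
  case False
  then have "H = {..Max H}"
    using assms(2)[OF Max_in[OF assms(1) False]] Max_in[OF assms(1) False] Max_ge[OF assms(1)]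
    by (auto simp: le_less simp del: Max_in)
  then show ?thesis by (metis card_atMost lessThan_Suc_atMost)
qed simp

lemma shape_of_columns_eq:
  "i \<in> {1..m} \<Longrightarrow> shape_of_columns m D i = length (filter (\<lambda>A. i \<le> length A) D)"
  by (simp add: shape_of_columns_def length_filter_conv_card)

lemma partition_shaped_nth:
  "partition_shaped D \<Longrightarrow> a < b \<Longrightarrow> b < length D \<Longrightarrow> length (D ! b) \<le> length (D ! a)"
  by (simp add: partition_shaped_def sorted_wrt_iff_nth_less)

lemma shape_partitions: "shape_of_columns m D \<in> partitions m"
proof -
  have "length (filter (\<lambda>A. Suc i \<le> length A) D) \<le> length (filter (\<lambda>A. i \<le> length A) D)" for i
    by (induction D) auto
  then show ?thesis
    by (auto simp: partitions_def shape_of_columns_eq) (auto simp: shape_of_columns_def)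
qed

text \<open>The columns reaching row \<open>i\<close> form an initial segment because the lengths
  decrease, so their number tells which ones they are.\<close>

lemma dg_shape:
  assumes "tableau_columns m D"
  shows "(i, j) \<in> dg m (shape_of_columns m D) \<longleftrightarrow>
    1 \<le> i \<and> 1 \<le> j \<and> j \<le> length D \<and> i \<le> length (D ! (j - 1))"
proof -
  have "{j. j < length D \<and> i \<le> length (D ! j)} = {..<card {j. j < length D \<and> i \<le> length (D ! j)}}"
    by (rule downset_eq_lessThan_card)
       (use assms partition_shaped_nth[of D] in \<open>fastforce simp: tableau_columns_def\<close>)+
  then have *: "j < length D \<and> i \<le> length (D ! j) \<longleftrightarrow> j < card {j. j < length D \<and> i \<le> length (D ! j)}" for j
    by blast
  have "i \<le> m" if "j < length D" "i \<le> length (D ! j)" for j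
    using assms column_length[of m "D ! j"] that by (auto simp: tableau_columns_def)
  then show ?thesis using *[of "j - 1"]
    by (cases j) (auto simp: dg_def shape_of_columns_def Suc_le_eq)
qed

lemma dg_shape_Suc:
  assumes "tableau_columns m D"
  shows "(Suc i, Suc a) \<in> dg m (shape_of_columns m D) \<longleftrightarrow> a < length D \<and> i < length (D ! a)"
  by (auto simp: dg_shape[OF assms])

lemma filling_of_columns_Suc:
  assumes "tableau_columns m D" "a < length D" "i < length (D ! a)"
  shows "filling_of_columns m D (Suc i, Suc a) = D ! a ! i"
  using assms by (simp add: filling_of_columns_def dg_shape_Suc)

lemma dg_cases:
  assumes "c \<in> dg m mu"
  obtains i a where "c = (Suc i, Suc a)"
proof -
  have "1 \<le> fst c" "1 \<le> snd c" using assms by (auto simp: dg_def)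
  then show ?thesis using that[of "fst c - 1" "snd c - 1"] by (cases c) auto
qed

lemma filling_of_columns_CSF:
  assumes "tableau_columns m D"
  shows "filling_of_columns m D \<in> CSF m (shape_of_columns m D)"
proof -
  have "filling_of_columns m D c \<in> {1..m}" if "c \<in> dg m (shape_of_columns m D)" for c
  proof -
    have "\<exists>i a. c = (Suc i, Suc a)" using dg_cases[OF that] by metis
    then obtain i a where c: "c = (Suc i, Suc a)" by blast
    then have "a < length D" "i < length (D ! a)" using that dg_shape_Suc[OF assms] by auto
    moreover from this have "column m (D ! a)" using assms by (simp add: tableau_columns_def)
    ultimately show ?thesis using column_nth_bounds c filling_of_columns_Suc[OF assms] by auto
  qed
  moreover have "column_strict m (shape_of_columns m D) (filling_of_columns m D)"
    unfolding column_strict_def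
  proof (intro allI impI)
    fix i j assume *: "(i, j) \<in> dg m (shape_of_columns m D) \<and> (Suc i, j) \<in> dg m (shape_of_columns m D)"
    then obtain k a where c: "i = Suc k" "j = Suc a" by (auto elim: dg_cases)
    then have "a < length D" "k < length (D ! a)" "Suc k < length (D ! a)"
      using * dg_shape_Suc[OF assms] by auto
    moreover from this have "column m (D ! a)" using assms by (simp add: tableau_columns_def)
    ultimately show "filling_of_columns m D (i, j) < filling_of_columns m D (Suc i, j)"
      using column_nth_less c filling_of_columns_Suc[OF assms] by auto
  qed
  ultimately show ?thesis
    by (auto simp: CSF_def fillings_def filling_of_columns_def)
qed

text \<open>\<open>columns\<close> with the number \<open>N\<close> of columns left free. Splicing
  keeps \<open>lam 1\<close> columns, while \<open>mu\<close> may have fewer nonempty ones, and for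
  \<open>m = 0\<close> the value \<open>mu 1\<close> carries no meaning.\<close>

definition padded_columns :: "nat \<Rightarrow> nat \<Rightarrow> part \<Rightarrow> filling \<Rightarrow> nat list list" where
  "padded_columns N m mu G =
     map (\<lambda>j. map (\<lambda>i. G (i, j)) [1..<Suc (card {i. (i, j) \<in> dg m mu})]) [1..<Suc N]"

lemma columns_eq_padded: "columns n lam F = padded_columns (lam 1) n lam F"
  by (simp add: columns_def padded_columns_def)

lemma padded_columns:
  assumes mu: "mu \<in> partitions m" and G: "G \<in> CSF m mu" and N: "\<And>i. i \<in> {1..m} \<Longrightarrow> mu i \<le> N"
  defines "D \<equiv> padded_columns N m mu G"
  shows "length D = N" "tableau_columns m D" "shape_of_columns m D = mu" "filling_of_columns m D = G"
proof -
  let ?h = "\<lambda>j. card {i. (i, j) \<in> dg m mu}"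
  have h: "(Suc i, Suc a) \<in> dg m mu \<longleftrightarrow> i < ?h (Suc a)" for i a
  proof -
    let ?H = "{i. (Suc i, Suc a) \<in> dg m mu}"
    have "?H = {..<card ?H}"
    proof (rule downset_eq_lessThan_card)
      show "finite ?H" by (rule finite_subset[of _ "{..m}"]) (auto simp: dg_def)
      show "i \<in> ?H" if "j \<in> ?H" "i < j" for i j
        using that partitions_antimono[OF mu, of "Suc i" "Suc j"] by (auto simp: dg_def)
    qed
    moreover have "card ?H = ?h (Suc a)"
    proof -
      have "{i. (i, Suc a) \<in> dg m mu} = Suc ` ?H"
        by (auto simp: image_def elim: dg_cases)
      then show ?thesis by (simp add: card_image)
    qed
    ultimately show ?thesis by auto
  qed
  show len: "length D = N" by (simp add: D_def padded_columns_def)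
  have nth: "D ! a = map (\<lambda>i. G (i, Suc a)) [1..<Suc (?h (Suc a))]" if "a < N" for a
    using that by (simp add: D_def padded_columns_def del: upt_Suc)
  have lenD: "length (D ! a) = ?h (Suc a)" if "a < N" for a using nth[OF that] by simp
  have ent: "D ! a ! i = G (Suc i, Suc a)" if "a < N" "i < ?h (Suc a)" for a i
    using that nth[OF that(1)] by (simp del: upt_Suc)
  have "column m (D ! a)" if a: "a < N" for a
  proof (rule columnI)
    fix i assume "Suc i < length (D ! a)"
    then show "D ! a ! i < D ! a ! Suc i"
      using G h[of i a] h[of "Suc i" a] a lenD ent by (auto simp: CSF_def column_strict_def)
  next
    fix i assume "i < length (D ! a)"
    then show "1 \<le> D ! a ! i \<and> D ! a ! i \<le> m"
      using G h[of i a] a lenD ent by (fastforce simp: CSF_def fillings_def)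
  qed
  moreover have "length (D ! b) \<le> length (D ! a)" if "a < b" "b < N" for a b
  proof -
    have *: "i < ?h (Suc a)" if "i < ?h (Suc b)" for i
      using h[of i b] h[of i a] that \<open>a < b\<close> by (auto simp: dg_def)
    then show ?thesis using lenD that *[of "?h (Suc a)"] by (simp add: not_less[symmetric]) blast
  qed
  ultimately show tab: "tableau_columns m D"
    using len by (auto simp: tableau_columns_def partition_shaped_def sorted_wrt_iff_nth_less in_set_conv_nth)
  have dg: "dg m (shape_of_columns m D) = dg m mu"
  proof (rule set_eqI)
    fix c
    show "c \<in> dg m (shape_of_columns m D) \<longleftrightarrow> c \<in> dg m mu"
    proof (cases "1 \<le> fst c \<and> 1 \<le> snd c")
      case True
      then obtain i a where c: "c = (Suc i, Suc a)" by (metis Suc_le_D One_nat_def prod.collapse)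
      have "a < N" if "(Suc i, Suc a) \<in> dg m mu" using that N[of "Suc i"] by (auto simp: dg_def)
      then show ?thesis using h[of i a] lenD by (auto simp: c dg_shape_Suc[OF tab] len)
    qed (auto simp: dg_def)
  qed
  show "shape_of_columns m D = mu"
  proof (rule extensionalityI[of _ "{1..m}"])
    show "shape_of_columns m D \<in> extensional {1..m}" by (simp add: shape_of_columns_def)
    show "mu \<in> extensional {1..m}" using mu by (simp add: partitions_def PiE_def)
    fix i assume i: "i \<in> {1..m}"
    have "j \<le> shape_of_columns m D i \<longleftrightarrow> j \<le> mu i" if "1 \<le> j" for j
      using dg i that unfolding dg_def by auto
    then show "shape_of_columns m D i = mu i"
      by (metis le_antisym le_refl less_one linorder_not_less bot_nat_0.extremum)
  qed
  show "filling_of_columns m D = G"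
  proof (rule extensionalityI[of _ "dg m mu"])
    show "filling_of_columns m D \<in> extensional (dg m mu)" by (simp add: filling_of_columns_def dg)
    show "G \<in> extensional (dg m mu)" using G by (simp add: CSF_def fillings_def PiE_def)
    fix c assume c: "c \<in> dg m mu"
    then obtain i a where c': "c = (Suc i, Suc a)" using dg_cases by blast
    then have "a < N" "i < length (D ! a)" using c dg dg_shape_Suc[OF tab] len by auto
    then show "filling_of_columns m D c = G c"
      using c' filling_of_columns_Suc[OF tab] ent lenD len by simp
  qed
qed

text \<open>The number of columns has to be compared as well, since empty columns leave no trace in
  shape and filling.\<close>

lemma tableau_columns_eqI:
  assumes "tableau_columns m D" "tableau_columns m D'" "length D = length D'"
    "shape_of_columns m D = shape_of_columns m D'" "filling_of_columns m D = filling_of_columns m D'"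
  shows "D = D'"
proof (rule nth_equalityI[OF assms(3)])
  fix a assume a: "a < length D"
  have "i < length (D ! a) \<longleftrightarrow> i < length (D' ! a)" for i
    using dg_shape_Suc[OF assms(1), of i a] dg_shape_Suc[OF assms(2), of i a] assms(3,4) a by simp
  then have l: "length (D ! a) = length (D' ! a)" by (metis linorder_neq_iff)
  then show "D ! a = D' ! a"
    using filling_of_columns_Suc[OF assms(1), of a] filling_of_columns_Suc[OF assms(2), of a] a assms(3,5)
    by (intro nth_equalityI) force+
qed

lemma gt_filling_of_columns:
  assumes "tableau_columns m D"
  shows "gt_of_tableau m (shape_of_columns m D) (filling_of_columns m D) =
    (\<lambda>(i, j)\<in>triangle m. row_count (i - 1) j D)"
proof -
  have "card {c. (i, c) \<in> dg m (shape_of_columns m D) \<and> filling_of_columns m D (i, c) \<le> j} =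
    row_count (i - 1) j D" if "1 \<le> i" for i j
  proof -
    obtain k where k: "i = Suc k" using \<open>1 \<le> i\<close> by (cases i) auto
    have "{c. (i, c) \<in> dg m (shape_of_columns m D) \<and> filling_of_columns m D (i, c) \<le> j} =
      Suc ` {a. a < length D \<and> ent (D ! a) k \<le> enat j}" (is "?L = ?R")
    proof (intro subset_antisym subsetI)
      fix c assume c: "c \<in> ?L"
      then obtain a where "c = Suc a" using k by (auto elim: dg_cases)
      then show "c \<in> ?R"
        using c k by (auto simp: dg_shape_Suc[OF assms] filling_of_columns_Suc[OF assms] ent_def)
    next
      fix c assume "c \<in> ?R"
      then show "c \<in> ?L" using k
        by (auto simp: dg_shape_Suc[OF assms] filling_of_columns_Suc[OF assms] ent_def split: if_splits)
    qed
    then show ?thesis by (simp add: card_image row_count_def length_filter_conv_card k)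
  qed
  then show ?thesis by (auto simp: gt_of_tableau_def triangle_def intro!: restrict_ext)
qed


section \<open>The statistics in terms of columns\<close>

lemma card_Sigma_pairs:
  assumes "inj_on f (SIGMA b:{..<N}. SIGMA a:{..<b}. X a b)" "\<And>a b. finite (X a b)"
  shows "card (f ` (SIGMA b:{..<N}. SIGMA a:{..<b}. X a b)) = (\<Sum>b<N. \<Sum>a<b :: nat. card (X a b))"
  using assms by (simp add: card_image card_SigmaI)

lemma quinv_stat_columns:
  assumes "tableau_columns m D"
  shows "quinv_stat m (shape_of_columns m D) (filling_of_columns m D) = int (qtotal D)"
proof -
  let ?f = "\<lambda>(b, a, i). ((Suc i, Suc a), (Suc (Suc i), Suc a), (Suc i, Suc b))"
  let ?X = "SIGMA b:{..<length D}. SIGMA a:{..<b}. qset (D ! a) (D ! b)"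
  note d = dg_shape_Suc[OF assms] filling_of_columns_Suc[OF assms]
  have "quinv_triples m (shape_of_columns m D) (filling_of_columns m D) = ?f ` ?X" (is "?L = ?R")
  proof (intro subset_antisym subsetI)
    fix t assume t: "t \<in> ?L"
    obtain x y z where xyz: "t = (x, y, z)" by (cases t)
    obtain i a where x: "x = (Suc i, Suc a)" using t xyz by (auto simp: quinv_triples_def elim: dg_cases)
    obtain k b where z: "z = (Suc k, Suc b)" using t xyz by (auto simp: quinv_triples_def elim: dg_cases)
    have "k = i" "a < b" "b < length D" "y = (Suc (Suc i), Suc a)" "i \<in> qset (D ! a) (D ! b)"
      using t by (auto simp: xyz x z quinv_triples_def d qset_def ent_def split: if_splits)
    then have "t = ?f (b, a, i)" "(b, a, i) \<in> ?X" by (auto simp: xyz x z)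
    then show "t \<in> ?R" by blast
  next
    fix t assume "t \<in> ?R"
    then obtain b a i where t: "t = ?f (b, a, i)" "b < length D" "a < b" "i \<in> qset (D ! a) (D ! b)" by auto
    then have "i < length (D ! b)" "i < length (D ! a)"
      by (auto simp: qset_def ent_def split: if_splits)
    then show "t \<in> ?L"
      using t by (auto simp: quinv_triples_def d qset_def ent_def split: if_splits)
  qed
  moreover have "inj_on ?f ?X" by (auto simp: inj_on_def)
  ultimately have "card (quinv_triples m (shape_of_columns m D) (filling_of_columns m D)) =
    (\<Sum>b<length D. \<Sum>a<b. qcount (D ! a) (D ! b))"
    unfolding qcount_def by (simp only: card_Sigma_pairs finite_qset)
  then show ?thesis by (simp add: quinv_stat_def qtotal_sum)
qed

text \<open>In a row of \<open>B\<close> other than its last, \<open>B ! i < B ! Suc i\<close> makes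
  at least one of \<open>B ! i < A ! i\<close> and \<open>A ! i < B ! Suc i\<close> true. Both hold
  exactly on \<open>qset B A\<close>, so adding the two and subtracting 1 counts that set. In the
  last row the upper bound is infinite and the first condition decides.\<close>

lemma qcount_inv:
  assumes "column m A" "column m B" "length B \<le> length A"
  shows "int (card {i. i < length B \<and> B ! i < A ! i}) + int (card {i. Suc i < length B \<and> A ! i < B ! Suc i})
    - int (card {i. Suc i < length B}) = int (qcount B A)"
proof -
  have fin: "finite {i. Suc i < length B \<and> P i}" for P
    by (rule finite_subset[of _ "{..<length B}"]) auto
  let ?Y = "{i. Suc i < length B \<and> \<not> A ! i < B ! Suc i}"
  have "card {i. Suc i < length B} = card {i. Suc i < length B \<and> A ! i < B ! Suc i} + card ?Y"
    by (subst card_Un_disjoint[symmetric]) (use fin in \<open>auto intro: arg_cong[of _ _ card]\<close>)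
  moreover have "{i. i < length B \<and> B ! i < A ! i} = qset B A \<union> ?Y"
  proof (rule set_eqI)
    fix i
    show "i \<in> {i. i < length B \<and> B ! i < A ! i} \<longleftrightarrow> i \<in> qset B A \<union> ?Y"
      using assms(3) column_nth_less[OF assms(2), of i "Suc i"]
      by (auto simp: qset_def ent_def split: if_splits)
  qed
  then have "card {i. i < length B \<and> B ! i < A ! i} = qcount B A + card ?Y"
    unfolding qcount_def
    by (simp only:, subst card_Un_disjoint) (use fin assms(3) in \<open>auto simp: qset_def ent_def split: if_splits\<close>)
  ultimately show ?thesis by simp
qed

text \<open>Strict columns make every cell below the top row a descent, so the arms count, for each
  pair of columns, the cells of the right one below the top row (\<open>?f3\<close>). Inversions lie
  within a row (\<open>?f1\<close>) or between consecutive rows (\<open>?f2\<close>), the lower cell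
  then being in the right column.\<close>

lemma inv_stat_columns:
  assumes "tableau_columns m D"
  shows "inv_stat m (shape_of_columns m D) (filling_of_columns m D) =
    (\<Sum>b<length D. \<Sum>a<b. int (qcount (D ! b) (D ! a)))"
proof -
  let ?dg = "dg m (shape_of_columns m D)" and ?G = "filling_of_columns m D"
  let ?S = "\<lambda>X. SIGMA b:{..<length D}. SIGMA a:{..<b}. X (D ! a) (D ! b)"
  let ?X1 = "\<lambda>A B. {i. i < length B \<and> B ! i < A ! i}"
  let ?X2 = "\<lambda>A B. {i. Suc i < length B \<and> A ! i < B ! Suc i}"
  let ?X3 = "\<lambda>A B. {i. Suc i < length B}"
  let ?f1 = "\<lambda>(b, a, i). ((Suc i, Suc a), (Suc i, Suc b))"
  let ?f2 = "\<lambda>(b, a, i). ((Suc (Suc i), Suc b), (Suc i, Suc a))"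
  let ?f3 = "\<lambda>(b, a, i). ((Suc (Suc i), Suc a), (Suc (Suc i), Suc b))"
  note d = dg_shape_Suc[OF assms] filling_of_columns_Suc[OF assms]
  have len: "length (D ! b) \<le> length (D ! a)" if "a < b" "b < length D" for a b
    using assms partition_shaped_nth that by (simp add: tableau_columns_def)
  have col: "column m (D ! a)" if "a < length D" for a
    using assms that by (simp add: tableau_columns_def)
  have inv: "Inv_pairs m (shape_of_columns m D) ?G = ?f1 ` ?S ?X1 \<union> ?f2 ` ?S ?X2" (is "?L = ?R1 \<union> ?R2")
  proof (intro subset_antisym subsetI)
    fix t assume t: "t \<in> ?L"
    obtain u w where uw: "t = (u, w)" by (cases t)
    obtain i a where u: "u = (Suc i, Suc a)" using t uw by (auto simp: Inv_pairs_def elim: dg_cases)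
    obtain k b where w: "w = (Suc k, Suc b)" using t uw by (auto simp: Inv_pairs_def elim: dg_cases)
    have "attack u w" "precedes u w" using t by (auto simp: uw Inv_pairs_def)
    then consider "i = k" "a < b" | "i = Suc k" "b < a"
      by (auto simp: attack_def precedes_def u w)
    then show "t \<in> ?R1 \<union> ?R2"
    proof cases
      case 1
      then have "t = ?f1 (b, a, i)" "(b, a, i) \<in> ?S ?X1"
        using t by (auto simp: uw u w Inv_pairs_def d)
      then show ?thesis by blast
    next
      case 2
      then have "t = ?f2 (a, b, k)" "(a, b, k) \<in> ?S ?X2"
        using t by (auto simp: uw u w Inv_pairs_def d)
      then show ?thesis by blast
    qed
  next
    fix t assume "t \<in> ?R1 \<union> ?R2"
    then show "t \<in> ?L"
    proof
      assume "t \<in> ?R1"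
      then obtain a b i where "t = ?f1 (b, a, i)" "b < length D" "a < b" "i \<in> ?X1 (D ! a) (D ! b)" by auto
      then show ?thesis using len[of a b] by (auto simp: Inv_pairs_def d attack_def precedes_def)
    next
      assume "t \<in> ?R2"
      then obtain a b i where "t = ?f2 (b, a, i)" "b < length D" "a < b" "i \<in> ?X2 (D ! a) (D ! b)" by auto
      then show ?thesis using len[of a b] by (auto simp: Inv_pairs_def d attack_def precedes_def)
    qed
  qed
  have fin: "finite (?X1 A B)" "finite (?X2 A B)" "finite (?X3 A B)" for A B :: "nat list"
    by (rule finite_subset[of _ "{..<length B}"]; auto)+
  have c: "card ?R1 = (\<Sum>b<length D. \<Sum>a<b. card (?X1 (D ! a) (D ! b)))"
    "card ?R2 = (\<Sum>b<length D. \<Sum>a<b. card (?X2 (D ! a) (D ! b)))"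
    "card (?f3 ` ?S ?X3) = (\<Sum>b<length D. \<Sum>a<b. card (?X3 (D ! a) (D ! b)))"
    by (rule card_Sigma_pairs; use fin in \<open>auto simp: inj_on_def\<close>)+
  have "finite (?S ?X1)" "finite (?S ?X2)" using fin by (auto intro!: finite_SigmaI)
  then have ci: "card (Inv_pairs m (shape_of_columns m D) ?G) = card ?R1 + card ?R2"
    unfolding inv by (subst card_Un_disjoint) auto
  let ?Des = "Des m (shape_of_columns m D) ?G"
  have finD: "finite ?dg"
    by (rule finite_subset[of _ "{..m} \<times> {..length D}"])
       (use dg_shape[OF assms] in \<open>auto simp: dg_def\<close>)
  then have finDes: "finite ?Des" by (rule rev_finite_subset) (auto simp: Des_def)
  have "(\<Sum>u\<in>?Des. arm m (shape_of_columns m D) u) =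
      card (SIGMA u:?Des. {w \<in> ?dg. fst w = fst u \<and> snd u < snd w})"
    using finDes finD by (simp add: card_SigmaI arm_def)
  also have "(SIGMA u:?Des. {w \<in> ?dg. fst w = fst u \<and> snd u < snd w}) = ?f3 ` ?S ?X3" (is "?L = ?R")
  proof (intro subset_antisym subsetI)
    fix t assume t: "t \<in> ?L"
    obtain u w where uw: "t = (u, w)" by (cases t)
    obtain i a where u: "u = (Suc i, Suc a)" using t uw by (auto simp: Des_def elim: dg_cases)
    obtain k b where w: "w = (Suc k, Suc b)" using t uw by (auto elim: dg_cases)
    obtain l where l: "i = Suc l" using t uw u by (cases i) (auto simp: Des_def)
    have "t = ?f3 (b, a, l)" "(b, a, l) \<in> ?S ?X3" using t by (auto simp: uw u w l d)
    then show "t \<in> ?R" by blast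
  next
    fix t assume "t \<in> ?R"
    then obtain a b i where "t = ?f3 (b, a, i)" "b < length D" "a < b" "i \<in> ?X3 (D ! a) (D ! b)" by auto
    then show "t \<in> ?L"
      using len[of a b] column_nth_less[OF col, of a i "Suc i"] by (auto simp: Des_def d)
  qed
  finally have "(\<Sum>u\<in>?Des. arm m (shape_of_columns m D) u) =
    (\<Sum>b<length D. \<Sum>a<b. card (?X3 (D ! a) (D ! b)))" using c by simp
  then have "(\<Sum>u\<in>?Des. int (arm m (shape_of_columns m D) u)) =
    (\<Sum>b<length D. \<Sum>a<b. int (card (?X3 (D ! a) (D ! b))))" by (metis (mono_tags, lifting) of_nat_sum sum.cong)
  then have "inv_stat m (shape_of_columns m D) ?G = (\<Sum>b<length D. \<Sum>a<b.
      int (card (?X1 (D ! a) (D ! b))) + int (card (?X2 (D ! a) (D ! b))) - int (card (?X3 (D ! a) (D ! b))))"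
    by (simp add: inv_stat_def ci c sum.distrib sum_subtractf)
  also have "\<dots> = (\<Sum>b<length D. \<Sum>a<b. int (qcount (D ! b) (D ! a)))"
    by (intro sum.cong refl qcount_inv[of m]) (use len col in auto)
  finally show ?thesis .
qed

section \<open>The sum of both statistics over all ordered pairs of columns\<close>

lemma sum_square_split:
  "(\<Sum>b<N. \<Sum>a<N. f a b) = (\<Sum>b<N. \<Sum>a<b. f a b + f b a) + (\<Sum>a<N. f a a :: int)" for N :: nat
  by (induction N) (auto simp: sum.distrib)

lemma row_count_sum: "int (row_count i j D) = (\<Sum>a<length D. of_bool (ent (D ! a) i \<le> enat j))"
proof -
  have "{..<length D} \<inter> {a. ent (D ! a) i \<le> enat j} = {a. a < length D \<and> ent (D ! a) i \<le> enat j}" by auto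
  then show ?thesis by (simp add: row_count_def length_filter_conv_card)
qed

text \<open>Grouping by the value \<open>Suc j\<close> of \<open>ent B i\<close> makes each summand
  a term in \<open>B\<close> times a term in \<open>A\<close>, so that the sum over all ordered
  pairs of columns factors. The first factor is the indicator of \<open>ent B i = Suc j\<close>,
  under which \<open>ent A i < ent B i\<close> reads \<open>ent A i \<le> j\<close>.\<close>

lemma qcount_by_value:
  assumes "column m A" "column m B"
  shows "int (qcount A B) = (\<Sum>i<m. \<Sum>j<m.
    (of_bool (ent B i \<le> enat (Suc j)) - of_bool (ent B i \<le> enat j)) *
    (of_bool (ent A i \<le> enat j) - of_bool (ent A (Suc i) \<le> enat (Suc j))))"
  unfolding qcount_expand[OF assms(1) column_length[OF assms(2)]]
proof (rule sum.cong[OF refl])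
  fix i
  let ?f = "\<lambda>j. (of_bool (ent B i \<le> enat (Suc j)) - of_bool (ent B i \<le> enat j)) *
    (of_bool (ent A i \<le> enat j) - of_bool (ent A (Suc i) \<le> enat (Suc j))) :: int"
  let ?g = "of_bool (ent A i < ent B i \<and> ent B i \<noteq> \<infinity>) - of_bool (ent A (Suc i) \<le> ent B i \<and> ent B i \<noteq> \<infinity>) :: int"
  show "?g = (\<Sum>j<m. ?f j)"
  proof (cases "ent B i")
    case infinity
    then show ?thesis by simp
  next
    case (enat v)
    then have "1 \<le> v" "v \<le> m" using column_nth_bounds[OF assms(2), of i] by (auto simp: ent_def split: if_splits)
    then obtain u where u: "v = Suc u" "u < m" by (cases v) auto
    have "?f j = (if j = u then ?g else 0)" for j
    proof -
      have "(Suc u \<le> Suc j) \<noteq> (Suc u \<le> j) \<longleftrightarrow> j = u" by auto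
      moreover have "(ent A i < enat (Suc u)) = (ent A i \<le> enat u)" by (cases "ent A i") auto
      ultimately show ?thesis using enat u by auto
    qed
    then show ?thesis using u by simp
  qed
qed

lemma row_count_mono: "row_count i j D \<le> row_count i (Suc j) D"
proof -
  have "ent A i \<le> enat (Suc j)" if "ent A i \<le> enat j" for A
    using that by (cases "ent A i") auto
  then show ?thesis unfolding row_count_def by (induction D) auto
qed

text \<open>In a strict column an entry at most \<open>Suc j\<close> has an entry at most
  \<open>j\<close> above it. Summed over the columns this is the interlacing inequality that makes
  \<open>SE\<close> a true difference.\<close>

lemma row_count_interlace:
  assumes "\<forall>A\<in>set D. column m A"
  shows "row_count (Suc i) (Suc j) D \<le> row_count i j D"
  using assms
proof (induction D)
  case (Cons A D)
  have "ent A i \<le> enat j" if "ent A (Suc i) \<le> enat (Suc j)"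
    using that Cons.prems column_nth_less[of m A i "Suc i"] by (auto simp: ent_def split: if_splits)
  then show ?case using Cons by (auto simp: row_count_def)
qed (simp add: row_count_def)

lemma row_count_zero:
  assumes "\<forall>A\<in>set D. column m A" "j \<le> i"
  shows "row_count i j D = 0"
  using assms column_nth_ge[of m _ i] by (fastforce simp: row_count_def filter_empty_conv ent_def)

lemma inv_plus_quinv:
  assumes "tableau_columns m D"
  defines "T \<equiv> gt_of_tableau m (shape_of_columns m D) (filling_of_columns m D)"
  shows "inv_stat m (shape_of_columns m D) (filling_of_columns m D) +
    quinv_stat m (shape_of_columns m D) (filling_of_columns m D) =
    int (\<Sum>(i, j)\<in>overlay_index m. NE T i j * SE T i j)"
proof -
  have col: "\<forall>A\<in>set D. column m A" using assms by (simp add: tableau_columns_def)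
  let ?N = "length D"
  let ?r = "\<lambda>i j. int (row_count i j D)"
  have "inv_stat m (shape_of_columns m D) (filling_of_columns m D) +
    quinv_stat m (shape_of_columns m D) (filling_of_columns m D) =
    (\<Sum>b<?N. \<Sum>a<?N. int (qcount (D ! a) (D ! b)))"
  proof -
    have "(\<Sum>a<?N. int (qcount (D ! a) (D ! a))) = 0"
      by (rule sum.neutral) (use qcount_self[of m] col in auto)
    then show ?thesis unfolding sum_square_split
      by (simp add: inv_stat_columns[OF assms(1)] quinv_stat_columns[OF assms(1)] qtotal_sum sum.distrib)
  qed
  also have "\<dots> = (\<Sum>b<?N. \<Sum>a<?N. \<Sum>i<m. \<Sum>j<m.
    (of_bool (ent (D ! b) i \<le> enat (Suc j)) - of_bool (ent (D ! b) i \<le> enat j)) *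
    (of_bool (ent (D ! a) i \<le> enat j) - of_bool (ent (D ! a) (Suc i) \<le> enat (Suc j))))"
    by (intro sum.cong refl qcount_by_value) (use col in auto)
  also have "\<dots> = (\<Sum>i<m. \<Sum>j<m. \<Sum>b<?N. \<Sum>a<?N. 
    (of_bool (ent (D ! b) i \<le> enat (Suc j)) - of_bool (ent (D ! b) i \<le> enat j)) *
    (of_bool (ent (D ! a) i \<le> enat j) - of_bool (ent (D ! a) (Suc i) \<le> enat (Suc j))))"
    by (simp only: sum.swap[of _ "{..<m}" "{..<?N}"])
  also have "\<dots> = (\<Sum>i<m. \<Sum>j<m. (?r i (Suc j) - ?r i j) * (?r i j - ?r (Suc i) (Suc j)))"
    by (simp only: sum_product[symmetric] sum_subtractf row_count_sum)
  also have "\<dots> = (\<Sum>(i, j)\<in>{..<m} \<times> {..<m}. (?r i (Suc j) - ?r i j) * (?r i j - ?r (Suc i) (Suc j)))"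
    by (simp add: sum.cartesian_product)
  \<comment> \<open>For \<open>j \<le> i\<close> both counts in the second factor vanish, because
    entries in row \<open>i\<close>, counted from 0, are at least \<open>Suc i\<close>.\<close>
  also have "\<dots> = (\<Sum>(i, j)\<in>{(i, j). i < j \<and> j < m}. (?r i (Suc j) - ?r i j) * (?r i j - ?r (Suc i) (Suc j)))"
  proof (rule sum.mono_neutral_right)
    have "(?r i (Suc j) - ?r i j) * (?r i j - ?r (Suc i) (Suc j)) = 0" if "\<not> i < j" for i j
      using row_count_zero[OF col, of j i] row_count_zero[OF col, of "Suc j" "Suc i"] that by simp
    then show "\<forall>x\<in>{..<m} \<times> {..<m} - {(i, j). i < j \<and> j < m}.
      (case x of (i, j) \<Rightarrow> (?r i (Suc j) - ?r i j) * (?r i j - ?r (Suc i) (Suc j))) = 0"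
      by (auto simp del: mult_eq_0_iff)
  qed auto
  \<comment> \<open>Rows are counted from 0 before this step and from 1 after it.\<close>
  also have "\<dots> = (\<Sum>(i, j)\<in>overlay_index m. int (NE T i j * SE T i j))"
  proof (rule sum.reindex_bij_witness[of _ "\<lambda>(i, j). (i - 1, j)" "\<lambda>(i, j). (Suc i, j)"])
    fix x assume "x \<in> {(i, j). i < j \<and> j < m}"
    then obtain i j where x: "x = (i, j)" "i < j" "j < m" by auto
    then have "(Suc i, j) \<in> triangle m" "(Suc i, Suc j) \<in> triangle m" "(Suc (Suc i), Suc j) \<in> triangle m"
      by (auto simp: triangle_def)
    then have "NE T (Suc i) j = row_count i (Suc j) D - row_count i j D"
      "SE T (Suc i) j = row_count i j D - row_count (Suc i) (Suc j) D"
      by (simp_all add: NE_def SE_def T_def gt_filling_of_columns[OF assms(1)])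
    then show "(case (case x of (i, j) \<Rightarrow> (Suc i, j)) of (i, j) \<Rightarrow> int (NE T i j * SE T i j)) =
      (case x of (i, j) \<Rightarrow> (?r i (Suc j) - ?r i j) * (?r i j - ?r (Suc i) (Suc j)))"
      using row_count_mono[of i j D] row_count_interlace[OF col, of i j] by (simp add: x of_nat_diff)
  qed (auto simp: overlay_index_def)
  finally show ?thesis by (simp add: case_prod_unfold)
qed


section \<open>Sorting rows\<close>

definition row_list :: "part \<Rightarrow> filling \<Rightarrow> nat \<Rightarrow> nat list" where
  "row_list lam F i = map (\<lambda>c. F (i, c)) [1..<Suc (lam i)]"

lemma length_row_list [simp]: "length (row_list lam F i) = lam i"
  by (simp add: row_list_def)

lemma row_list_nth: "a < lam i \<Longrightarrow> row_list lam F i ! a = F (i, Suc a)"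
  by (simp add: row_list_def del: upt_Suc)

lemma row_list_rsort:
  assumes "1 \<le> i" "i \<le> n"
  shows "row_list lam (rsort n lam F) i = sort (row_list lam F i)"
  by (rule nth_equalityI)
     (use assms in \<open>simp_all add: row_list_nth rsort_def dg_def row_list_def[of lam F i] del: upt_Suc\<close>)

lemma rsort_nth:
  assumes "1 \<le> i" "i \<le> n" "a < lam i"
  shows "rsort n lam F (i, Suc a) = sort (row_list lam F i) ! a"
  using row_list_nth[of a lam i "rsort n lam F"] row_list_rsort[OF assms(1,2)] assms(3) by simp

lemma gt_of_tableau_row_list:
  "gt_of_tableau n lam F = (\<lambda>(i, j)\<in>triangle n. length (filter (\<lambda>v. v \<le> j) (row_list lam F i)))"
  unfolding gt_of_tableau_def
proof (rule restrict_ext)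
  fix x assume "x \<in> triangle n"
  then obtain i j where x: "x = (i, j)" "1 \<le> i" "i \<le> n" by (auto simp: triangle_def)
  have "{c. (i, c) \<in> dg n lam \<and> F (i, c) \<le> j} = Suc ` {a. a < lam i \<and> row_list lam F i ! a \<le> j}" (is "?L = ?R")
  proof (intro subset_antisym subsetI)
    fix c assume c: "c \<in> ?L"
    then obtain a where "c = Suc a" by (auto elim: dg_cases)
    then show "c \<in> ?R" using c by (auto simp: row_list_nth dg_def)
  qed (use x in \<open>auto simp: row_list_nth dg_def\<close>)
  then show "(case x of (i, j) \<Rightarrow> card {c. (i, c) \<in> dg n lam \<and> F (i, c) \<le> j}) =
    (case x of (i, j) \<Rightarrow> length (filter (\<lambda>v. v \<le> j) (row_list lam F i)))"
    by (simp add: x card_image length_filter_conv_card)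
qed

lemma length_filter_sort: "length (filter P (sort xs)) = length (filter P (xs :: nat list))"
  by (metis mset_filter mset_sort size_mset)

lemma gt_of_tableau_rsort: "gt_of_tableau n lam (rsort n lam F) = gt_of_tableau n lam F"
  unfolding gt_of_tableau_row_list
  by (rule restrict_ext) (auto simp: triangle_def row_list_rsort length_filter_sort)

lemma xweight_row_list: "xweight n lam F = (\<Prod>i\<in>{1..n}. \<Prod>v\<leftarrow>row_list lam F i. xvar v)"
proof -
  have "dg n lam = (SIGMA i:{1..n}. {1..lam i})" by (auto simp: dg_def)
  then have "xweight n lam F = (\<Prod>i\<in>{1..n}. \<Prod>c\<in>{1..lam i}. xvar (F (i, c)))"
    by (simp add: xweight_def prod.Sigma case_prod_unfold)
  also have "\<dots> = (\<Prod>i\<in>{1..n}. \<Prod>v\<leftarrow>row_list lam F i. xvar v)"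
  proof (rule prod.cong[OF refl])
    fix i
    have "(\<Prod>v\<leftarrow>row_list lam F i. xvar v) = (\<Prod>c\<in>set [1..<Suc (lam i)]. xvar (F (i, c)))"
      by (simp add: row_list_def o_def prod.distinct_set_conv_list del: upt_Suc set_upt)
    then show "(\<Prod>c\<in>{1..lam i}. xvar (F (i, c))) = (\<Prod>v\<leftarrow>row_list lam F i. xvar v)"
      by (simp add: atLeastLessThanSuc_atLeastAtMost del: upt_Suc)
  qed
  finally show ?thesis .
qed

lemma xweight_rsort: "xweight n lam (rsort n lam F) = xweight n lam F"
proof -
  have "prod_list (map xvar (sort xs)) = prod_list (map xvar xs)" for xs
    by (metis mset_map mset_sort prod_mset_prod_list)
  then show ?thesis unfolding xweight_row_list by (intro prod.cong refl) (simp add: row_list_rsort)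
qed

text \<open>Otherwise, with \<open>v\<close> the entry of \<open>sort ys\<close> at
  \<open>a\<close>, at most \<open>a\<close> entries of \<open>xs\<close> lie below
  \<open>v\<close>, while more than \<open>a\<close> entries of \<open>ys\<close> are at most
  \<open>v\<close>; but each index of the latter kind is one of the former. Applied to consecutive
  rows, this keeps columns strict under row sorting.\<close>

lemma sort_strict_mono:
  assumes "length ys \<le> length xs" "\<And>k. k < length ys \<Longrightarrow> xs ! k < ys ! k" "a < length ys"
  shows "sort xs ! a < sort (ys :: nat list) ! a"
proof (rule ccontr)
  define v where "v = sort ys ! a"
  assume "\<not> sort xs ! a < sort ys ! a"
  then have v: "v \<le> sort xs ! a" by (simp add: v_def)
  have "\<forall>x\<in>set (drop a (sort xs)). \<not> x < v"
  proof
    fix x assume "x \<in> set (drop a (sort xs))"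
    then obtain k where "k < length xs - a" "x = sort xs ! (a + k)"
      by (auto simp: in_set_conv_nth)
    then have "sort xs ! a \<le> x" by (simp add: sorted_nth_mono)
    then show "\<not> x < v" using v by simp
  qed
  then have "filter (\<lambda>x. x < v) (drop a (sort xs)) = []" by (simp add: filter_empty_conv)
  then have "length (filter (\<lambda>x. x < v) (sort xs)) = length (filter (\<lambda>x. x < v) (take a (sort xs)))"
    by (metis append_Nil2 append_take_drop_id filter_append)
  also have "\<dots> \<le> a" using length_filter_le[of _ "take a (sort xs)"] by (metis length_take min.boundedE)
  finally have 1: "length (filter (\<lambda>x. x < v) xs) \<le> a" by (simp add: length_filter_sort)
  have "\<forall>x\<in>set (take (Suc a) (sort ys)). x \<le> v"
  proof
    fix x assume "x \<in> set (take (Suc a) (sort ys))"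
    then obtain k where "k < Suc a" "x = sort ys ! k" by (auto simp: in_set_conv_nth)
    then show "x \<le> v" using assms(3) by (simp add: v_def sorted_nth_mono)
  qed
  then have "filter (\<lambda>x. x \<le> v) (take (Suc a) (sort ys)) = take (Suc a) (sort ys)" by (simp add: filter_id_conv)
  then have "Suc a \<le> length (filter (\<lambda>x. x \<le> v) (sort ys))"
    using assms(3) by (metis Suc_leI append_take_drop_id filter_append le_add1 length_append length_sort length_take min.absorb2)
  then have 2: "Suc a \<le> length (filter (\<lambda>x. x \<le> v) ys)" by (simp add: length_filter_sort)
  have "length (filter (\<lambda>x. x \<le> v) ys) \<le> length (filter (\<lambda>x. x < v) xs)"
    unfolding length_filter_conv_card
    by (rule card_mono) (use assms(1,2) in \<open>fastforce dest: less_le_trans\<close>)+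
  then show False using 1 2 by simp
qed

lemma dg_row_above:
  assumes "lam \<in> partitions n" "(Suc (Suc i), c) \<in> dg n lam"
  shows "(Suc i, c) \<in> dg n lam"
  using assms partitions_antimono[OF assms(1), of "Suc i" "Suc (Suc i)"] by (auto simp: dg_def)

lemma CSF_ge_row:
  assumes "lam \<in> partitions n" "F \<in> CSF n lam" "(Suc i, c) \<in> dg n lam"
  shows "Suc i \<le> F (Suc i, c)"
  using assms(3)
proof (induction i)
  case 0 then show ?case using assms(2) by (fastforce simp: CSF_def fillings_def)
next
  case (Suc i)
  note dg_row_above[OF assms(1) Suc.prems]
  moreover from this have "F (Suc i, c) < F (Suc (Suc i), c)"
    using Suc.prems assms(2) by (auto simp: CSF_def column_strict_def)
  ultimately show ?case using Suc.IH by simp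
qed

lemma rsort_SSYT:
  assumes "lam \<in> partitions n" "F \<in> CSF n lam"
  shows "rsort n lam F \<in> SSYT n lam"
proof -
  have "rsort n lam F c \<in> {1..n}" if mem: "c \<in> dg n lam" for c
  proof -
    obtain i a where c: "c = (i, Suc a)" "1 \<le> i" "i \<le> n" "a < lam i"
      using mem by (cases c; cases "snd c") (auto simp: dg_def)
    have "sort (row_list lam F i) ! a \<in> set (row_list lam F i)"
      by (metis c(4) length_row_list length_sort nth_mem set_sort)
    then obtain k where "k < lam i" "sort (row_list lam F i) ! a = F (i, Suc k)"
      by (auto simp: in_set_conv_nth row_list_nth)
    moreover have "F (i, Suc k) \<in> {1..n}" if "k < lam i" for k
      using assms(2) that c by (auto simp: CSF_def fillings_def dg_def)
    ultimately show ?thesis using c by (simp add: rsort_nth)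
  qed
  moreover have "row_weak n lam (rsort n lam F)"
    unfolding row_weak_def
  proof (intro allI impI)
    fix i j assume "(i, j) \<in> dg n lam \<and> (i, Suc j) \<in> dg n lam"
    then obtain a where "j = Suc a" "1 \<le> i" "i \<le> n" "Suc a < lam i" by (cases j) (auto simp: dg_def)
    then show "rsort n lam F (i, j) \<le> rsort n lam F (i, Suc j)"
      by (simp add: rsort_nth sorted_nth_mono)
  qed
  moreover have "column_strict n lam (rsort n lam F)"
    unfolding column_strict_def
  proof (intro allI impI)
    fix i j assume "(i, j) \<in> dg n lam \<and> (Suc i, j) \<in> dg n lam"
    then obtain a where a: "j = Suc a" "1 \<le> i" "Suc i \<le> n" "a < lam i" "a < lam (Suc i)"
      by (cases j) (auto simp: dg_def)
    have l: "lam (Suc i) \<le> lam i" using assms(1) a by (auto simp: partitions_def)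
    have "F (i, Suc k) < F (Suc i, Suc k)" if "k < lam (Suc i)" for k
      using assms(2) that a l by (auto simp: CSF_def column_strict_def dg_def)
    then have "sort (row_list lam F i) ! a < sort (row_list lam F (Suc i)) ! a"
      by (intro sort_strict_mono) (use a l in \<open>simp_all add: row_list_nth\<close>)
    then show "rsort n lam F (i, j) < rsort n lam F (Suc i, j)"
      using a by (simp add: rsort_nth)
  qed
  ultimately show ?thesis by (auto simp: SSYT_def fillings_def rsort_def)
qed

lemma SSYT_subset_CSF: "SSYT n lam \<subseteq> CSF n lam"
  by (auto simp: SSYT_def CSF_def)

text \<open>Rows increase weakly, so the entry in column \<open>Suc a\<close> is at most
  \<open>j\<close> exactly when more than \<open>a\<close> entries of its row are. Taking for
  \<open>j\<close> the entry of \<open>S\<close> at a cell bounds the entry of \<open>S'\<close>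
  there. Such a \<open>j\<close> is a legitimate pattern row, since entries are at least their row
  number.\<close>

lemma gt_of_tableau_inj:
  assumes "lam \<in> partitions n"
  shows "inj_on (gt_of_tableau n lam) (SSYT n lam)"
proof -
  have le: "S' c \<le> S c"
    if S: "S \<in> SSYT n lam" and S': "S' \<in> SSYT n lam" and eq: "gt_of_tableau n lam S = gt_of_tableau n lam S'"
      and c: "c \<in> dg n lam" for S S' c
  proof -
    obtain i a where ia: "c = (i, Suc a)" "1 \<le> i" "i \<le> n" "a < lam i"
      using c by (cases c; cases "snd c") (auto simp: dg_def)
    let ?j = "S c"
    let ?H = "\<lambda>S. {b. b < lam i \<and> S (i, Suc b) \<le> ?j}"
    have H: "?H R = {..<card (?H R)}" if R: "R \<in> SSYT n lam" for R
    proof (rule downset_eq_lessThan_card)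
      show "b \<in> ?H R" if "b' \<in> ?H R" "b < b'" for b' b
      proof -
        have "R (i, Suc b) \<le> R (i, Suc b')"
          using that(2)[THEN less_imp_le] that(1)
        proof (induction b' rule: dec_induct)
          case (step k)
          then have "R (i, Suc k) \<le> R (i, Suc (Suc k))"
            using R ia by (auto simp: SSYT_def row_weak_def dg_def)
          then show ?case using step by auto
        qed simp
        then show ?thesis using that by auto
      qed
    qed simp
    have "?j \<in> {1..n}" using S c by (auto simp: SSYT_def fillings_def)
    moreover have "i \<le> ?j"
      using CSF_ge_row[OF assms, of S "i - 1" "Suc a"] S SSYT_subset_CSF ia c by auto
    ultimately have tri: "(i, ?j) \<in> triangle n" using ia by (simp add: triangle_def)
    have "gt_of_tableau n lam R (i, ?j) = card (?H R)" for R
    proof -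
      have "{b. b < lam i \<and> row_list lam R i ! b \<le> ?j} = ?H R" by (auto simp: row_list_nth)
      then show ?thesis using tri by (simp add: gt_of_tableau_row_list length_filter_conv_card)
    qed
    then have "card (?H S) = card (?H S')" using eq by metis
    moreover have "a < card (?H S)" using ia by (subst lessThan_iff[symmetric], subst H[OF S, symmetric]) simp
    ultimately have "a \<in> ?H S'" by (subst H[OF S']) simp
    then show ?thesis using ia by simp
  qed
  show ?thesis
  proof (rule inj_onI)
    fix S S' assume *: "S \<in> SSYT n lam" "S' \<in> SSYT n lam" "gt_of_tableau n lam S = gt_of_tableau n lam S'"
    then have "S \<in> extensional (dg n lam)" "S' \<in> extensional (dg n lam)"
      by (auto simp: SSYT_def fillings_def PiE_def)
    then show "S = S'"
      by (rule extensionalityI) (metis * le le_antisym)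
  qed
qed

lemma xweight_gt_of_tableau:
  assumes "lam \<in> partitions n" "F \<in> CSF n lam"
  shows "xweight_gt n lam (gt_of_tableau n lam F) = xweight n lam F"
proof -
  have "tableau_of_gt n lam (gt_of_tableau n lam F) = rsort n lam F"
    unfolding tableau_of_gt_def gt_of_tableau_rsort[symmetric, of n lam F]
    by (rule the_inv_into_f_f[OF gt_of_tableau_inj[OF assms(1)] rsort_SSYT[OF assms]])
  then show ?thesis by (simp add: xweight_gt_def xweight_rsort)
qed


section \<open>The effect of dsplice\<close>

lemma columns_facts:
  assumes "n \<ge> 1" "lam \<in> partitions n" "F \<in> CSF n lam"
  shows "length (columns n lam F) = lam 1" "tableau_columns n (columns n lam F)"
    "shape_of_columns n (columns n lam F) = lam" "filling_of_columns n (columns n lam F) = F"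
  unfolding columns_eq_padded
  by (intro padded_columns assms; use assms partitions_antimono[OF assms(2), of 1] in auto)+

lemma length_del:
  assumes "column n A"
  shows "length A = length (del n A) + of_bool (n \<in> set A)"
  by (subst ent_filter_max(3)[OF assms]) (simp del: filter_append)

lemma col_system_del:
  assumes "tableau_columns n C"
  shows "col_system (n - 1) (map length C) (map (del n) C)"
proof -
  have "length (del n A) \<le> length A \<and> length A \<le> Suc (length (del n A)) \<and> column (n - 1) (del n A)"
    if "A \<in> set C" for A
    using that assms length_del[of n A] ent_filter_max(2)[of n A] by (auto simp: tableau_columns_def)
  then show ?thesis
    using assms by (auto simp: col_system_def tableau_columns_def partition_shaped_def
        list_all2_map1 list_all2_map2 intro!: list_all2_refl list.rel_refl_strong)
qed

lemma dsplice_columns_unique: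
  assumes "n \<ge> 1" "lam \<in> partitions n" "F \<in> CSF n lam"
    "splice_step\<^sup>*\<^sup>* (map (del n) (columns n lam F)) D" "partition_shaped D"
  shows "dsplice_columns n lam F = D"
  unfolding dsplice_columns_def
  by (rule the_equality)
     (use assms(4,5) splice_normal_form_unique[OF col_system_del[OF columns_facts(2)[OF assms(1-3)]]] in blast)+

lemma dsplice_columns_facts:
  assumes "n \<ge> 1" "lam \<in> partitions n" "F \<in> CSF n lam"
  defines "C \<equiv> columns n lam F" and "D \<equiv> dsplice_columns n lam F"
  shows "splice_step\<^sup>*\<^sup>* (map (del n) C) D" "partition_shaped D" "tableau_columns (n - 1) D"
    "length D = lam 1"
proof -
  note cs = col_system_del[OF columns_facts(2)[OF assms(1-3)], folded C_def]
  show s: "splice_step\<^sup>*\<^sup>* (map (del n) C) D" and p: "partition_shaped D"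
    using splice_normal_form[OF cs] dsplice_columns_unique[OF assms(1-3)] unfolding C_def D_def by metis+
  show "tableau_columns (n - 1) D"
    using tableau_columns_col_system[OF splice_steps_col_system[OF s cs] p] .
  show "length D = lam 1"
    using splice_steps_invariants(3)[OF s cs] columns_facts(1)[OF assms(1-3)]
    unfolding C_def by (metis length_map mset_eq_length)
qed

text \<open>A column loses row \<open>i\<close> exactly when it has length \<open>i\<close> and
  contains \<open>n\<close>. In terms of \<open>lam\<close> and \<open>mu\<close>, the equations
  identify the numbers of letters \<open>True\<close> and \<open>False\<close> in the word of index
  \<open>i\<close> with \<open>NE\<close> and \<open>SE\<close> at
  \<open>(i, n - 1)\<close>.\<close>

lemma count_del:
  assumes "\<forall>A\<in>set C. column n A" "i \<ge> 1"
  shows "length (filter (\<lambda>A. i \<le> length A) (map (del n) C)) +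
      length (filter (\<lambda>A. length A = i \<and> n \<in> set A) C) = length (filter (\<lambda>A. i \<le> length A) C)"
    and "length (filter (\<lambda>A. i \<le> length A) (map (del n) C)) =
      length (filter (\<lambda>A. length A = i \<and> n \<notin> set A) C) + length (filter (\<lambda>A. Suc i \<le> length A) C)"
proof -
  have "length (filter (\<lambda>A. i \<le> length A) (map (del n) C)) +
      length (filter (\<lambda>A. length A = i \<and> n \<in> set A) C) = length (filter (\<lambda>A. i \<le> length A) C) \<and>
    length (filter (\<lambda>A. i \<le> length A) (map (del n) C)) =
      length (filter (\<lambda>A. length A = i \<and> n \<notin> set A) C) + length (filter (\<lambda>A. Suc i \<le> length A) C)"
    using assms(1)
  proof (induction C)
    case (Cons A C)
    then show ?case using length_del[of n A] by (cases "n \<in> set A") auto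
  qed simp
  then show "length (filter (\<lambda>A. i \<le> length A) (map (del n) C)) +
      length (filter (\<lambda>A. length A = i \<and> n \<in> set A) C) = length (filter (\<lambda>A. i \<le> length A) C)"
    "length (filter (\<lambda>A. i \<le> length A) (map (del n) C)) =
      length (filter (\<lambda>A. length A = i \<and> n \<notin> set A) C) + length (filter (\<lambda>A. Suc i \<le> length A) C)"
    by auto
qed

lemma length_filter_length:
  fixes C D :: "'a list list"
  assumes "mset (map length C) = mset (map length D)"
  shows "length (filter (\<lambda>A. i \<le> length A) C) = length (filter (\<lambda>A. i \<le> length A) D)"
proof -
  have s: "length (filter (\<lambda>A. i \<le> length A) C) = size (filter_mset (\<lambda>x. i \<le> x) (mset (map length C)))" for C :: "'a list list"
    by (induction C) auto
  show ?thesis unfolding s assms ..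
qed

text \<open>Splicing only rearranges the column lengths, so \<open>mu\<close> can be computed right
  after the deletion; row counts and \<open>qtotal\<close> are carried across the splices as
  well.\<close>

lemma dsplice_facts:
  assumes "lam \<in> partitions (Suc m)" "F \<in> CSF (Suc m) lam" "dsplice (Suc m) lam F = (mu, G)"
  defines "C \<equiv> columns (Suc m) lam F"
  shows "mu \<in> interlacing (Suc m) lam" "mu \<in> partitions m" "G \<in> CSF m mu"
    "\<And>i. i \<in> {1..m} \<Longrightarrow> word_part (word (Suc m) i C) \<in> fits (lam i - mu i) (mu i - lam (Suc i))"
    "quinv_stat (Suc m) lam F = quinv_stat m mu G + int (\<Sum>i\<in>{1..m}. sum_list (word_part (word (Suc m) i C)))"
    "gt_of_tableau (Suc m) lam F = (\<lambda>(i, j)\<in>triangle (Suc m). if j = Suc m then lam i else gt_of_tableau m mu G (i, j))"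
proof -
  let ?n = "Suc m"
  define D where "D = dsplice_columns ?n lam F"
  have n1: "?n \<ge> 1" by simp
  note CF = columns_facts[OF n1 assms(1,2), folded C_def]
  note DF = dsplice_columns_facts[OF n1 assms(1,2), folded C_def D_def, unfolded diff_Suc_1]
  note cs = col_system_del[OF CF(2), unfolded diff_Suc_1]
  have col: "\<forall>A\<in>set C. column ?n A" using CF(2) by (simp add: tableau_columns_def)
  have mu: "mu = shape_of_columns m D" and G: "G = filling_of_columns m D"
    using assms(3) by (simp_all add: dsplice_def D_def Let_def)
  show "mu \<in> partitions m" unfolding mu by (rule shape_partitions)
  show "G \<in> CSF m mu" unfolding mu G by (rule filling_of_columns_CSF[OF DF(3)])
  have lam: "lam i = length (filter (\<lambda>A. i \<le> length A) C)" if "i \<in> {1..?n}" for i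
    using shape_of_columns_eq[OF that, of C] CF(3) by simp
  have mui: "mu i = length (filter (\<lambda>A. i \<le> length A) (map (del ?n) C))" if "i \<in> {1..m}" for i
    unfolding mu shape_of_columns_eq[OF that]
    by (rule length_filter_length) (use splice_steps_invariants(3)[OF DF(1) cs] in simp)
  have w: "length (filter id (word ?n i C)) + mu i = lam i"
    "mu i = length (filter Not (word ?n i C)) + lam (Suc i)" if "i \<in> {1..m}" for i
    using that count_del[OF col, of i] lam[of i] lam[of "Suc i"] mui[of i]
    by (simp_all add: length_filter_word)
  show "mu \<in> interlacing ?n lam"
    unfolding interlacing_def
  proof (intro CollectI conjI allI impI)
    show "mu \<in> {1..?n - 1} \<rightarrow>\<^sub>E UNIV" by (simp add: mu shape_of_columns_def)
    show "lam (Suc i) \<le> mu i" "mu i \<le> lam i" if "1 \<le> i \<and> i < ?n" for i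
      using that w[of i] by auto
  qed
  show "word_part (word ?n i C) \<in> fits (lam i - mu i) (mu i - lam (Suc i))" if "i \<in> {1..m}" for i
  proof -
    have "length (filter id (word ?n i C)) = lam i - mu i"
      "length (filter Not (word ?n i C)) = mu i - lam (Suc i)" using w[OF that] by auto
    then show ?thesis using word_part_fits[of "word ?n i C"] by simp
  qed
  have "(\<Sum>i\<le>?n. sum_list (word_part (word ?n i C))) = (\<Sum>i\<in>{1..m}. sum_list (word_part (word ?n i C)))"
  proof (rule sum.mono_neutral_right)
    show "\<forall>i\<in>{..?n} - {1..m}. sum_list (word_part (word ?n i C)) = 0"
      by (intro ballI sum_list_word_part_full[OF col]) auto
  qed auto
  then show "quinv_stat ?n lam F = quinv_stat m mu G + int (\<Sum>i\<in>{1..m}. sum_list (word_part (word ?n i C)))"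
    using quinv_stat_columns[OF CF(2)] quinv_stat_columns[OF DF(3)] CF(3,4) qtotal_delete[OF col]
      splice_steps_invariants(1)[OF DF(1) cs] by (simp add: mu G)
  \<comment> \<open>All entries are at most \<open>?n\<close>, so the count with this bound is the
    length of the row with 1-based index \<open>Suc i\<close>.\<close>
  have r: "row_count i ?n C = length (filter (\<lambda>A. Suc i \<le> length A) C)" for i
    unfolding row_count_def
    by (intro arg_cong[of _ _ length] filter_cong refl)
       (use col column_nth_bounds[of ?n _ i] in \<open>auto simp: ent_def\<close>)
  have "row_count (i - 1) j C = (if j = ?n then lam i else gt_of_tableau m mu G (i, j))"
    if ij: "(i, j) \<in> triangle ?n" for i j
  proof (cases "j = ?n")
    case True
    then show ?thesis using r[of "i - 1"] lam[of i] ij by (simp add: triangle_def)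
  next
    case False
    then have "(i, j) \<in> triangle m" "j < ?n" using ij by (auto simp: triangle_def)
    then show ?thesis
      using gt_filling_of_columns[OF DF(3)] row_count_delete[OF col, of j "i - 1"]
        splice_steps_invariants(2)[OF DF(1) cs, of "i - 1" j] by (simp add: mu G)
  qed
  then show "gt_of_tableau ?n lam F = (\<lambda>(i, j)\<in>triangle ?n. if j = ?n then lam i else gt_of_tableau m mu G (i, j))"
    using gt_filling_of_columns[OF CF(2)] CF(3,4) by (auto intro: restrict_ext)
qed

section \<open>Recovering a filling from its dsplice and its words\<close>

lemma shape_lengths:
  assumes "tableau_columns m D" "tableau_columns m D'" "length D = length D'"
    "shape_of_columns m D = shape_of_columns m D'"
  shows "map length D = map length D'"
proof (rule nth_equalityI)
  fix a assume a: "a < length (map length D)"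
  have "i < length (D ! a) \<longleftrightarrow> i < length (D' ! a)" for i
    using dg_shape_Suc[OF assms(1), of i a] dg_shape_Suc[OF assms(2), of i a] assms(3,4) a by simp
  then show "map length D ! a = map length D' ! a"
    using a assms(3) by (simp, metis linorder_neq_iff)
qed (use assms in simp)

text \<open>Only the words with index in \<open>{1..m}\<close> enter the overlay. The others are
  forced: no column is longer than \<open>Suc m\<close>, a full one contains \<open>Suc m\<close>,
  and an empty one does not.\<close>

lemma word_outside:
  assumes "\<forall>A\<in>set C. column (Suc m) A" "i \<notin> {1..m}"
  shows "word (Suc m) i C = replicate (length (filter (\<lambda>l. l = i) (map length C))) (i = Suc m)"
proof -
  have "b = (i = Suc m)" if mem: "b \<in> set (word (Suc m) i C)" for b
  proof -
    obtain A where A: "A \<in> set C" "length A = i" "b = (Suc m \<in> set A)" using mem by (auto simp: word_def)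
    then have "column (Suc m) A" using assms(1) by simp
    then show ?thesis using A assms(2) full_column_max[of "Suc m" A] column_length[of "Suc m" A]
      by (cases "i = 0") auto
  qed
  then have "word (Suc m) i C = replicate (length (word (Suc m) i C)) (i = Suc m)"
    by (rule replicate_eqI[OF refl])
  moreover have "length (word (Suc m) i C) = length (filter (\<lambda>l. l = i) (map length C))"
    by (simp add: word_def filter_map o_def)
  ultimately show ?thesis by simp
qed

text \<open>The words locate the entries \<open>Suc m\<close>, hence the column lengths after the
  deletion agree, and \<open>splice_step_injective\<close> makes the columns agree. Putting
  \<open>Suc m\<close> back at the bottom recovers the filling.\<close>

lemma dsplice_word_inj:
  assumes "lam \<in> partitions (Suc m)" "F \<in> CSF (Suc m) lam" "F' \<in> CSF (Suc m) lam"
    "dsplice (Suc m) lam F = dsplice (Suc m) lam F'"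
    "\<And>i. i \<in> {1..m} \<Longrightarrow> word_part (word (Suc m) i (columns (Suc m) lam F)) =
       word_part (word (Suc m) i (columns (Suc m) lam F'))"
  shows "F = F'"
proof -
  let ?n = "Suc m"
  define C where "C = columns ?n lam F"
  define C' where "C' = columns ?n lam F'"
  have n1: "?n \<ge> 1" by simp
  note CF = columns_facts[OF n1 assms(1,2), folded C_def]
  note CF' = columns_facts[OF n1 assms(1,3), folded C'_def]
  note DF = dsplice_columns_facts[OF n1 assms(1,2), folded C_def, unfolded diff_Suc_1]
  note DF' = dsplice_columns_facts[OF n1 assms(1,3), folded C'_def, unfolded diff_Suc_1]
  have col: "\<forall>A\<in>set C. column ?n A" "\<forall>A\<in>set C'. column ?n A"
    using CF(2) CF'(2) by (simp_all add: tableau_columns_def)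
  have len: "map length C = map length C'"
    by (rule shape_lengths[OF CF(2) CF'(2)]) (use CF CF' in simp_all)
  have lw: "length (word ?n i C) = length (word ?n i C')" for i
  proof -
    have "length (word ?n i C) = length (filter (\<lambda>l. l = i) (map length C))" for C
      by (simp add: word_def filter_map o_def)
    then show ?thesis by (simp only: len)
  qed
  have "word ?n i C = word ?n i C'" for i
  proof (cases "i \<in> {1..m}")
    case True
    show ?thesis by (rule word_part_inj[OF lw]) (use assms(5)[OF True] in \<open>simp add: C_def C'_def\<close>)
  next
    case False
    then show ?thesis using word_outside[OF col(1)] word_outside[OF col(2)] len by simp
  qed
  then have mem: "map (\<lambda>A. ?n \<in> set A) C = map (\<lambda>A. ?n \<in> set A) C'" by (rule word_determines[OF len])
  have lC: "length C = length C'" using CF CF' by simp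
  have nthe: "length (C ! a) = length (C' ! a)" "(?n \<in> set (C ! a)) = (?n \<in> set (C' ! a))"
    if "a < length C" for a
    using arg_cong[OF len, of "\<lambda>xs. xs ! a"] arg_cong[OF mem, of "\<lambda>xs. xs ! a"] that lC by simp_all
  have "map length (map (del ?n) C) = map length (map (del ?n) C')"
  proof (rule nth_equalityI)
    fix a assume "a < length (map length (map (del ?n) C))"
    then have a: "a < length C" "a < length C'" using lC by simp_all
    then have "column ?n (C ! a)" "column ?n (C' ! a)" using col by simp_all
    then show "map length (map (del ?n) C) ! a = map length (map (del ?n) C') ! a"
      using nthe[OF a(1)] length_del[of ?n "C ! a"] length_del[of ?n "C' ! a"] a by auto
  qed (simp add: lC)
  \<comment> \<open>Shape and filling determine the spliced columns once their number is known; it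
    is \<open>lam 1\<close> in both cases.\<close>
  moreover have "dsplice_columns ?n lam F = dsplice_columns ?n lam F'"
    by (rule tableau_columns_eqI[OF DF(3) DF'(3)])
       (use assms(4) DF(4) DF'(4) in \<open>simp_all add: dsplice_def Let_def\<close>)
  ultimately have e: "map (del ?n) C = map (del ?n) C'"
    using splice_step_injective[OF col_system_del[OF CF(2)], of "map (del ?n) C'"]
      col_system_del[OF CF'(2)] DF(1,2) DF'(1) len by simp
  have "C = C'"
  proof (rule nth_equalityI[OF lC])
    fix a assume a: "a < length C"
    then have "column ?n (C ! a)" "column ?n (C' ! a)" using col lC by simp_all
    moreover have "del ?n (C ! a) = del ?n (C' ! a)" using arg_cong[OF e, of "\<lambda>xs. xs ! a"] a lC by simp
    ultimately show "C ! a = C' ! a"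
      using ent_filter_max(3)[of ?n "C ! a"] ent_filter_max(3)[of ?n "C' ! a"] nthe(2)[OF a] by metis
  qed
  then show ?thesis using CF(4) CF'(4) by simp
qed

section \<open>Realising a given dsplice together with given words\<close>

lemma mset_eq_counts:
  assumes "\<And>i. length (filter (\<lambda>x. i \<le> x) xs) = length (filter (\<lambda>x. i \<le> x) (ys :: nat list))"
  shows "mset xs = mset ys"
proof (rule multiset_eqI)
  fix i
  have "count (mset xs) i + length (filter (\<lambda>x. Suc i \<le> x) xs) = length (filter (\<lambda>x. i \<le> x) xs)" for xs
    by (induction xs) auto
  then show "count (mset xs) i = count (mset ys) i" using assms by (metis add_right_cancel)
qed

lemma interlacing_partitions: "mu \<in> interlacing (Suc m) lam \<Longrightarrow> mu \<in> partitions m"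
proof -
  assume mu: "mu \<in> interlacing (Suc m) lam"
  have "mu (Suc i) \<le> mu i" if "1 \<le> i" "i < m" for i
  proof -
    have "mu (Suc i) \<le> lam (Suc i)" "lam (Suc i) \<le> mu i" using mu that by (auto simp: interlacing_def)
    then show ?thesis by simp
  qed
  then show ?thesis using mu by (simp add: partitions_def interlacing_def)
qed

text \<open>The letters prescribe the column lengths \<open>h\<close> after the deletion,
  \<open>splice_step_surjective\<close> yields columns of these lengths that lead to those of
  \<open>G\<close>, and \<open>Suc m\<close> is appended where the letter is
  \<open>True\<close>.\<close>

lemma dsplice_word_surj:
  assumes "lam \<in> partitions (Suc m)" "mu \<in> interlacing (Suc m) lam" "G \<in> CSF m mu"
    "\<And>i. i \<in> {1..m} \<Longrightarrow> g i \<in> fits (lam i - mu i) (mu i - lam (Suc i))"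
  shows "\<exists>F\<in>CSF (Suc m) lam. dsplice (Suc m) lam F = (mu, G) \<and>
    (\<forall>i\<in>{1..m}. word_part (word (Suc m) i (columns (Suc m) lam F)) = g i)"
proof -
  let ?n = "Suc m"
  have n1: "?n \<ge> 1" by simp
  have il: "lam (Suc i) \<le> mu i" "mu i \<le> lam i" if "i \<in> {1..m}" for i
    using assms(2) that by (auto simp: interlacing_def)
  have mu: "mu \<in> partitions m" using assms(2) by (rule interlacing_partitions)
  \<comment> \<open>The column lengths are read off the filling whose entries are the row indices.\<close>
  define F0 where "F0 = (\<lambda>(i, j)\<in>dg ?n lam. i)"
  have F0: "F0 \<in> CSF ?n lam"
    by (auto simp: F0_def CSF_def fillings_def column_strict_def dg_def)
  define C0 where "C0 = columns ?n lam F0"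
  note CF = columns_facts[OF n1 assms(1) F0, folded C0_def]
  define c where "c = map length C0"
  have c_sorted: "sorted_wrt (\<ge>) c" using CF(2) by (simp add: c_def tableau_columns_def partition_shaped_def)
  have lc: "length c = lam 1" by (simp add: c_def CF)
  have lam: "lam i = length (filter (\<lambda>l. i \<le> l) c)" if "i \<in> {1..?n}" for i
    using shape_of_columns_eq[OF that, of C0] CF(3) by (simp add: c_def filter_map o_def)
  have c_le: "l \<le> ?n" if "l \<in> set c" for l
    using that CF(2) column_length by (auto simp: c_def tableau_columns_def)
  \<comment> \<open>\<open>lam 1\<close> is both the number of columns and the number of nonempty
    ones. So no column is empty, and the subtraction in \<open>h\<close> is not truncated.\<close>
  have c_ge: "1 \<le> l" if "l \<in> set c" for l
  proof (rule ccontr)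
    assume "\<not> 1 \<le> l"
    then have "length (filter (\<lambda>l. 1 \<le> l) c) < length c" by (rule length_filter_less[OF that])
    then show False using lam[of 1] lc by simp
  qed
  have c_eq: "length (filter (\<lambda>l. l = i) c) + length (filter (\<lambda>l. Suc i \<le> l) c) = length (filter (\<lambda>l. i \<le> l) c)" for i
    by (induction c) auto
  have "\<exists>w. \<forall>i\<in>{1..m}. word_part (w i) = g i \<and> length (filter id (w i)) = lam i - mu i \<and>
      length (filter Not (w i)) = mu i - lam (Suc i)"
    using word_part_surj[OF assms(4)] by (intro bchoice) blast
  then obtain w0 where w0: "\<And>i. i \<in> {1..m} \<Longrightarrow> word_part (w0 i) = g i \<and>
      length (filter id (w0 i)) = lam i - mu i \<and> length (filter Not (w0 i)) = mu i - lam (Suc i)" by blast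
  \<comment> \<open>Outside \<open>{1..m}\<close> only the length \<open>Suc m\<close> occurs in
    \<open>c\<close>, and full columns must contain \<open>Suc m\<close>; hence the constant
    word.\<close>
  define w where "w i = (if i \<in> {1..m} then w0 i else replicate (length (filter (\<lambda>l. l = i) c)) True)" for i
  have "length (w i) = length (filter (\<lambda>l. l = i) c)" for i
  proof (cases "i \<in> {1..m}")
    case True
    have "length (w0 i) = length (filter id (w0 i)) + length (filter Not (w0 i))"
      using sum_length_filter_compl[of id "w0 i"] by (simp add: id_def)
    then show ?thesis using True w0[OF True] il[OF True] c_eq[of i] lam[of i] lam[of "Suc i"]
      by (simp add: w_def)
  qed (auto simp: w_def)
  then obtain bs where bs: "length bs = length c"
    "\<And>i. map snd (filter (\<lambda>x. fst x = i) (zip c bs)) = w i" using word_realize[of w c] by blast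
  define h where "h = map (\<lambda>(l, b). l - of_bool b) (zip c bs)"
  define D where "D = padded_columns (lam 1) m mu G"
  have mu_le: "mu i \<le> lam 1" if "i \<in> {1..m}" for i
    using il[OF that] partitions_antimono[OF assms(1), of 1 i] that by auto
  have DF: "length D = lam 1" "tableau_columns m D" "shape_of_columns m D = mu"
    "filling_of_columns m D = G"
    unfolding D_def by (intro padded_columns mu assms(3) mu_le; assumption)+
  have hc: "list_all2 (\<lambda>l x. x \<le> l \<and> l \<le> Suc x) c h"
    using bs(1) by (auto simp: list_all2_conv_all_nth h_def)
  \<comment> \<open>By interlacing, \<open>lam\<close> exceeds \<open>mu\<close> by a horizontal
    strip, that is, by at most one cell in each column.\<close>
  have csD: "col_system m c D"
    unfolding col_system_def list_all2_conv_all_nth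
  proof (intro conjI allI impI c_sorted)
    show "length c = length D" using lc DF by simp
    fix a assume a: "a < length c"
    then have a': "a < lam 1" "a < length D" using lc DF by simp_all
    show "column m (D ! a)" using DF(2) a' by (simp add: tableau_columns_def)
    have dgc: "(Suc i, Suc a) \<in> dg ?n lam \<longleftrightarrow> i < c ! a" for i
      using dg_shape_Suc[OF CF(2), of i a] CF(1,3) a' by (simp add: c_def)
    have dgD: "(Suc i, Suc a) \<in> dg m mu \<longleftrightarrow> i < length (D ! a)" for i
      using dg_shape_Suc[OF DF(2), of i a] DF a' by simp
    have "i < c ! a" if "i < length (D ! a)" for i
      using dgc[of i] dgD[of i] that il[of "Suc i"] by (auto simp: dg_def)
    then show "length (D ! a) \<le> c ! a" by (metis not_le less_irrefl)
    have "i < length (D ! a)" if "Suc i < c ! a" for i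
      using dgc[of "Suc i"] dgD[of i] that il[of "Suc i"] by (auto simp: dg_def)
    then show "c ! a \<le> Suc (length (D ! a))" by (metis not_le less_irrefl)
  qed
  have "mset h = mset (map length D)"
  proof (rule mset_eq_counts)
    fix i
    have lD: "length (filter (\<lambda>x. i \<le> x) (map length D)) = length (filter (\<lambda>A. i \<le> length A) D)"
      by (simp add: filter_map o_def)
    have lz: "(l, b) \<in> set (zip c bs) \<Longrightarrow> l \<in> set c" for l b by (rule set_zip_leftD)
    consider "i = 0" | "i \<in> {1..m}" | "i > m" by fastforce
    then show "length (filter (\<lambda>x. i \<le> x) h) = length (filter (\<lambda>x. i \<le> x) (map length D))"
    proof cases
      case 1
      then show ?thesis using bs(1) lc DF by (simp add: h_def)
    next
      case 2
      \<comment> \<open>After the removal a column has length at least \<open>i\<close> if it was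
        longer than \<open>i\<close>, or if it had length \<open>i\<close> and letter
        \<open>False\<close>.\<close>
      have "length (filter (\<lambda>x. i \<le> x) (map (\<lambda>(l, b). l - of_bool b) z)) =
          length (filter Not (map snd (filter (\<lambda>x. fst x = i) z))) +
          length (filter (\<lambda>l. Suc i \<le> l) (map fst z))" if "\<forall>x\<in>set z. 1 \<le> fst x" for z :: "(nat \<times> bool) list"
        using that 2 by (induction z) auto
      from this[of "zip c bs"] have "length (filter (\<lambda>x. i \<le> x) h) = length (filter Not (w i)) + length (filter (\<lambda>l. Suc i \<le> l) c)"
        using c_ge lz bs by (fastforce simp: h_def)
      also have "\<dots> = mu i" using 2 w0[OF 2] il[OF 2] lam[of "Suc i"] by (simp add: w_def)
      also have "\<dots> = length (filter (\<lambda>A. i \<le> length A) D)" using shape_of_columns_eq[OF 2, of D] DF(3) by simp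
      finally show ?thesis using lD by simp
    next
      case 3
      \<comment> \<open>Nothing may remain beyond row \<open>m\<close>: columns of length
        \<open>?n\<close> carry the letter \<open>True\<close> and lose a cell.\<close>
      have "l - of_bool b < i" if lb: "(l, b) \<in> set (zip c bs)" for l b
      proof (cases "l = ?n")
        case True
        have "b \<in> set (map snd (filter (\<lambda>x. fst x = ?n) (zip c bs)))" using lb True by force
        then have "b" by (auto simp: bs(2) w_def)
        then show ?thesis using True 3 by simp
      next
        case False
        then show ?thesis using c_le[OF lz[OF lb]] 3 by simp
      qed
      then have "filter (\<lambda>x. i \<le> x) h = []" by (force simp: h_def filter_empty_conv)
      moreover have "filter (\<lambda>A. i \<le> length A) D = []"
        using DF(2) column_length[of m] 3 by (fastforce simp: filter_empty_conv tableau_columns_def)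
      ultimately show ?thesis using lD by simp
    qed
  qed
  then obtain C' where C': "col_system m c C'" "map length C' = h" "splice_step\<^sup>*\<^sup>* C' D"
    using splice_step_surjective[OF c_sorted hc csD] DF(2) by (auto simp: tableau_columns_def)
  have lC': "length C' = length c" using C'(2) bs(1) by (metis h_def length_map length_zip min.idem)
  define C where "C = map (\<lambda>(A, b). if b then A @ [?n] else A) (zip C' bs)"
  have lC: "length C = length c" by (simp add: C_def lC' bs)
  have nC: "C ! a = (if bs ! a then C' ! a @ [?n] else C' ! a)" if "a < length c" for a
    using that by (simp add: C_def lC' bs)
  have colC': "column m (C' ! a)" if "a < length c" for a
    using C'(1) that by (simp add: col_system_def list_all2_conv_all_nth)
  have colC: "column ?n (C ! a)" if "a < length c" for a
    using colC'[OF that] by (fastforce simp: nC[OF that] column_def sorted_wrt_append)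
  have memC: "?n \<in> set (C ! a) \<longleftrightarrow> bs ! a" if "a < length c" for a
    using colC'[OF that] by (auto simp: nC[OF that] column_def)
  have lenC: "length (C ! a) = c ! a" if a: "a < length c" for a
  proof -
    have "length (C' ! a) = c ! a - of_bool (bs ! a)"
      using arg_cong[OF C'(2), of "\<lambda>xs. xs ! a"] a lC' bs(1) by (simp add: h_def)
    then show ?thesis using c_ge[of "c ! a"] a by (auto simp: nC)
  qed
  have delC: "map (del ?n) C = C'"
  proof (rule nth_equalityI)
    fix a assume "a < length (map (del ?n) C)"
    then have a: "a < length c" using lC by simp
    have "?n \<notin> set (C' ! a)" using colC'[OF a] by (auto simp: column_def)
    then have "del ?n (C' ! a) = C' ! a" by (auto simp: filter_id_conv)
    then show "map (del ?n) C ! a = C' ! a" using a lC by (simp add: nC)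
  qed (simp add: lC lC')
  have mlC: "map length C = c" by (rule nth_equalityI) (simp_all add: lC lenC)
  have tabC: "tableau_columns ?n C"
    using c_sorted colC lC by (auto simp: tableau_columns_def partition_shaped_def mlC in_set_conv_nth)
  have shC: "shape_of_columns ?n C = lam"
  proof -
    have "shape_of_columns ?n C i = shape_of_columns ?n C0 i" for i
    proof (cases "i \<in> {1..?n}")
      case True
      show ?thesis unfolding shape_of_columns_eq[OF True]
        by (rule length_filter_length) (simp only: mlC c_def)
    qed (auto simp: shape_of_columns_def)
    then show ?thesis using CF(3) by auto
  qed
  define F where "F = filling_of_columns ?n C"
  have F: "F \<in> CSF ?n lam" using filling_of_columns_CSF[OF tabC] shC by (simp add: F_def)
  note CFF = columns_facts[OF n1 assms(1) F]
  have CF_eq: "columns ?n lam F = C"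
    by (rule tableau_columns_eqI[OF CFF(2) tabC]) (use CFF lC lc shC in \<open>simp_all add: F_def\<close>)
  have "dsplice_columns ?n lam F = D"
    by (rule dsplice_columns_unique[OF n1 assms(1) F])
       (use C'(3) DF(2) in \<open>simp_all add: CF_eq delC tableau_columns_def\<close>)
  then have "dsplice ?n lam F = (mu, G)" by (simp add: dsplice_def Let_def DF)
  moreover have "word_part (word ?n i (columns ?n lam F)) = g i" if i: "i \<in> {1..m}" for i
  proof -
    have "map (\<lambda>A. (length A, ?n \<in> set A)) C = zip c bs"
      by (rule nth_equalityI) (simp_all add: lC bs lenC memC)
    then have "word ?n i C = w i"
      unfolding bs(2)[symmetric] by (simp add: word_def filter_map o_def flip: \<open>_ = zip c bs\<close>)
    then show ?thesis using w0[OF i] i by (simp add: CF_eq w_def)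
  qed
  ultimately show ?thesis using F by blast
qed


section \<open>Box complementation\<close>

lemma complement_fits: "g \<in> fits k l \<Longrightarrow> complement l g \<in> fits k l"
proof -
  have "sorted_wrt (\<ge>) (map (\<lambda>p. l - p) xs)" if "sorted_wrt (\<le>) xs" for xs
    using that by (induction xs) auto
  then show "g \<in> fits k l \<Longrightarrow> complement l g \<in> fits k l"
    by (auto simp: fits_def complement_def sorted_wrt_rev)
qed

lemma complement_complement: "g \<in> fits k l \<Longrightarrow> complement l (complement l g) = g"
  by (auto simp: fits_def complement_def rev_map[symmetric] o_def intro!: map_idI)

lemma sum_list_complement:
  assumes "g \<in> fits k l"
  shows "sum_list (complement l g) + sum_list g = k * l"
proof -
  have "(\<forall>p\<in>set g. p \<le> l) \<Longrightarrow> sum_list (map (\<lambda>p. l - p) g) + sum_list g = length g * l" for g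
    by (induction g) auto
  moreover have "sum_list (complement l g) = sum_list (map (\<lambda>p. l - p) g)"
    by (simp add: complement_def rev_map[symmetric] del: rev_map)
  ultimately show ?thesis using assms by (simp add: fits_def)
qed

lemma overlay_size_eq: "overlay_size n L = (\<Sum>x\<in>overlay_index n. sum_list (L x))"
  by (simp add: overlay_size_def case_prod_unfold)

lemma POP_fits:
  "(T, L) \<in> POP n lam \<Longrightarrow> (i, j) \<in> overlay_index n \<Longrightarrow> L (i, j) \<in> fits (NE T i j) (SE T i j)"
  by (auto simp: POP_def)

lemma bcomp_POP:
  assumes "P \<in> POP n lam"
  shows "bcomp n P \<in> POP n lam"
proof -
  obtain T L where P: "P = (T, L)" by (cases P)
  show ?thesis
    using assms POP_fits[OF assms[unfolded P]]
    by (auto simp: P POP_def bcomp_def intro!: complement_fits)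
qed

lemma fst_bcomp [simp]: "fst (bcomp n P) = fst P"
  by (simp add: bcomp_def case_prod_unfold)

lemma bcomp_bcomp:
  assumes "P \<in> POP n lam"
  shows "bcomp n (bcomp n P) = P"
proof -
  obtain T L where P: "P = (T, L)" by (cases P)
  have "(\<lambda>(i, j)\<in>overlay_index n. complement (SE T i j) (complement (SE T i j) (L (i, j)))) =
    restrict L (overlay_index n)"
    using complement_complement[OF POP_fits[OF assms[unfolded P]]] by (intro restrict_ext) auto
  also have "\<dots> = L" using assms by (auto simp: P POP_def PiE_def extensional_restrict)
  finally show ?thesis
    by (simp add: P bcomp_def case_prod_unfold cong: restrict_cong)
qed

lemma bij_betw_bcomp: "bij_betw (bcomp n) (POP n lam) (POP n lam)"
  by (rule bij_betw_byWitness[where f' = "bcomp n"]) (auto simp: bcomp_bcomp bcomp_POP)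

lemma overlay_size_bcomp:
  assumes "(T, L) \<in> POP n lam"
  shows "overlay_size n (snd (bcomp n (T, L))) + overlay_size n L =
    (\<Sum>(i, j)\<in>overlay_index n. NE T i j * SE T i j)"
proof -
  have "sum_list (complement (SE T i j) (L (i, j))) + sum_list (L (i, j)) = NE T i j * SE T i j"
    if "(i, j) \<in> overlay_index n" for i j
    by (rule sum_list_complement[OF POP_fits[OF assms that]])
  then have "(\<Sum>(i, j)\<in>overlay_index n. sum_list (complement (SE T i j) (L (i, j))) + sum_list (L (i, j))) =
    (\<Sum>(i, j)\<in>overlay_index n. NE T i j * SE T i j)"
    by (intro sum.cong) auto
  moreover have "overlay_size n (snd (bcomp n (T, L))) =
    (\<Sum>(i, j)\<in>overlay_index n. sum_list (complement (SE T i j) (L (i, j))))"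
    unfolding overlay_size_def bcomp_def by (rule sum.cong) auto
  ultimately show ?thesis
    by (simp add: overlay_size_def case_prod_unfold sum.distrib)
qed

text \<open>For \<open>j < m\<close> the value \<open>SE T i j\<close> reads rows \<open>j\<close>
  and \<open>Suc j\<close> only, and \<open>Suc j \<le> m\<close>, so complementation there does not
  see the deleted bounding row.\<close>

lemma br_bcomp:
  assumes "br (Suc m) P = (mu, P')"
  shows "br (Suc m) (bcomp (Suc m) P) = (mu, bcomp m P')"
proof -
  obtain T L where P: "P = (T, L)" by (cases P)
  have SE: "SE (restrict T (triangle m)) i j = SE T i j" if "(i, j) \<in> overlay_index m" for i j
    using that by (auto simp: SE_def overlay_index_def triangle_def)
  have "overlay_index m \<subseteq> overlay_index (Suc m)" by (auto simp: overlay_index_def)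
  then have "restrict (\<lambda>(i, j)\<in>overlay_index (Suc m). complement (SE T i j) (L (i, j))) (overlay_index m) =
    (\<lambda>(i, j)\<in>overlay_index m. complement (SE (restrict T (triangle m)) i j) (restrict L (overlay_index m) (i, j)))"
    by (intro ext) (auto simp: SE)
  then show ?thesis using assms by (auto simp: P br_def bcomp_def)
qed


section \<open>The bijections\<close>

text \<open>The overlay row \<open>j = m\<close> records the positions of the entry
  \<open>Suc m\<close>. For \<open>n = 0\<close> all index sets are empty, and the everywhere
  undefined functions form the only POP.\<close>

fun psi_quinv :: "nat \<Rightarrow> part \<Rightarrow> filling \<Rightarrow> pop" where
  "psi_quinv 0 lam F = (\<lambda>_. undefined, \<lambda>_. undefined)"
| "psi_quinv (Suc m) lam F =
     (let (mu, G) = dsplice (Suc m) lam F; (T, L) = psi_quinv m mu G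
      in (\<lambda>(i, j)\<in>triangle (Suc m). if j = Suc m then lam i else T (i, j),
          \<lambda>(i, j)\<in>overlay_index (Suc m).
            if j = m then word_part (word (Suc m) i (columns (Suc m) lam F)) else L (i, j)))"

declare psi_quinv.simps(2) [simp del]

text \<open>One level of \<open>br\<close> is inverted: the rectangles in row \<open>m\<close>
  depend on \<open>lam\<close> and \<open>mu\<close> only, so the partitions \<open>g\<close> can be
  chosen independently of the POP of shape \<open>mu\<close>.\<close>

lemma POP_Suc_intro:
  assumes "lam \<in> partitions (Suc m)" "mu \<in> interlacing (Suc m) lam" "(T, L) \<in> POP m mu"
    "\<forall>i\<in>{1..m}. g i \<in> fits (lam i - mu i) (mu i - lam (Suc i))"
  defines "T' \<equiv> \<lambda>(i, j)\<in>triangle (Suc m). if j = Suc m then lam i else T (i, j)"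
    and "L' \<equiv> \<lambda>(i, j)\<in>overlay_index (Suc m). if j = m then g i else L (i, j)"
  shows "(T', L') \<in> POP (Suc m) lam" "br (Suc m) (T', L') = (mu, (T, L))"
    "overlay_size (Suc m) L' = overlay_size m L + (\<Sum>i\<in>{1..m}. sum_list (g i))"
proof -
  have T: "T \<in> triangle m \<rightarrow>\<^sub>E UNIV" "\<And>i. i \<in> {1..m} \<Longrightarrow> T (i, m) = mu i"
    "\<And>i j. 1 \<le> i \<Longrightarrow> i \<le> j \<Longrightarrow> j < m \<Longrightarrow> T (i, j) \<le> T (i, Suc j) \<and> T (Suc i, Suc j) \<le> T (i, j)"
    and L: "L \<in> PiE (overlay_index m) (\<lambda>(i, j). fits (NE T i j) (SE T i j))"
    using assms(3) by (auto simp: POP_def GT_def)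
  have il: "lam (Suc i) \<le> mu i" "mu i \<le> lam i" if "i \<in> {1..m}" for i
    using assms(2) that by (auto simp: interlacing_def)
  have T1: "T' (i, Suc m) = lam i" if "i \<in> {1..Suc m}" for i
    using that by (simp add: T'_def triangle_def)
  have T2: "T' (i, j) = T (i, j)" if "(i, j) \<in> triangle m" for i j
    using that by (auto simp: T'_def triangle_def)
  have "T' (i, j) \<le> T' (i, Suc j) \<and> T' (Suc i, Suc j) \<le> T' (i, j)" if "1 \<le> i" "i \<le> j" "j < Suc m" for i j
  proof (cases "j = m")
    case True
    then show ?thesis using that T1[of i] T1[of "Suc i"] T2[of i m] T(2)[of i] il[of i]
      by (auto simp: triangle_def)
  next
    case False
    then show ?thesis using that T2[of i j] T2[of i "Suc j"] T2[of "Suc i" "Suc j"] T(3)[of i j]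
      by (auto simp: triangle_def)
  qed
  then have GT: "T' \<in> GT (Suc m) lam"
    using T1 by (auto simp: GT_def) (auto simp: T'_def)
  have "L' (i, j) \<in> fits (NE T' i j) (SE T' i j)" if ij: "(i, j) \<in> overlay_index (Suc m)" for i j
  proof (cases "j = m")
    case True
    then have "NE T' i j = lam i - mu i" "SE T' i j = mu i - lam (Suc i)" "i \<in> {1..m}"
      using ij T1[of i] T1[of "Suc i"] T2[of i m] T(2)[of i]
      by (auto simp: NE_def SE_def overlay_index_def triangle_def)
    then show ?thesis using assms(4) ij True by (simp add: L'_def)
  next
    case False
    then have "(i, j) \<in> overlay_index m" using ij by (auto simp: overlay_index_def)
    moreover from this have "NE T' i j = NE T i j" "SE T' i j = SE T i j"
      using T2[of i j] T2[of i "Suc j"] T2[of "Suc i" "Suc j"]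
      by (auto simp: NE_def SE_def overlay_index_def triangle_def)
    ultimately show ?thesis using L ij False by (auto simp: L'_def)
  qed
  then show "(T', L') \<in> POP (Suc m) lam"
    using GT by (auto simp: POP_def) (auto simp: L'_def)
  have "(\<lambda>i\<in>{1..m}. T' (i, m)) = mu"
    by (rule extensionalityI[of _ "{1..m}"])
       (use assms(2) T(2) T2 in \<open>auto simp: interlacing_def PiE_def triangle_def\<close>)
  moreover have "restrict T' (triangle m) = T"
    by (rule extensionalityI[of _ "triangle m"]) (use T(1) T2 in \<open>auto simp: PiE_def\<close>)
  moreover have L2: "L' x = L x" if "x \<in> overlay_index m" for x
    using that by (auto simp: L'_def overlay_index_def)
  then have "restrict L' (overlay_index m) = L"
    by (intro extensionalityI[of _ "overlay_index m"]) (use L in \<open>auto simp: PiE_def\<close>)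
  ultimately show "br (Suc m) (T', L') = (mu, (T, L))" by (simp add: br_def)
  have fin: "finite (overlay_index m)"
    by (rule finite_subset[of _ "{..m} \<times> {..m}"]) (auto simp: overlay_index_def)
  have "overlay_index (Suc m) = overlay_index m \<union> (\<lambda>i. (i, m)) ` {1..m}"
    by (auto simp: overlay_index_def)
  then have "overlay_size (Suc m) L' = (\<Sum>x\<in>overlay_index m. sum_list (L' x)) +
      (\<Sum>x\<in>(\<lambda>i. (i, m)) ` {1..m}. sum_list (L' x))"
    unfolding overlay_size_eq
    by (simp only:, intro sum.union_disjoint fin) (auto simp: overlay_index_def)
  also have "(\<Sum>x\<in>(\<lambda>i. (i, m)) ` {1..m}. sum_list (L' x)) = (\<Sum>i\<in>{1..m}. sum_list (L' (i, m)))"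
    by (subst sum.reindex) (auto simp: inj_on_def)
  also have "\<dots> = (\<Sum>i\<in>{1..m}. sum_list (g i))"
    by (rule sum.cong) (auto simp: L'_def overlay_index_def)
  finally show "overlay_size (Suc m) L' = overlay_size m L + (\<Sum>i\<in>{1..m}. sum_list (g i))"
    using L2 by (simp add: overlay_size_eq)
qed

lemma psi_quinv_properties:
  assumes "lam \<in> partitions n" "F \<in> CSF n lam"
  shows "psi_quinv n lam F \<in> POP n lam \<and> fst (psi_quinv n lam F) = gt_of_tableau n lam F \<and>
    quinv_stat n lam F = int (overlay_size n (snd (psi_quinv n lam F)))"
  using assms
proof (induction n arbitrary: lam F)
  case 0
  have "overlay_index 0 = {}" "triangle 0 = {}" "quinv_triples 0 lam F = {}"
    by (auto simp: overlay_index_def triangle_def quinv_triples_def dg_def)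
  moreover from this have "(\<lambda>_. undefined, \<lambda>_. undefined) \<in> POP 0 lam"
    by (auto simp: POP_def GT_def)
  ultimately show ?case
    by (auto simp: gt_of_tableau_def quinv_stat_def overlay_size_def restrict_def)
next
  case (Suc m)
  obtain mu G where ds: "dsplice (Suc m) lam F = (mu, G)" by fastforce
  note d = dsplice_facts[OF Suc.prems ds]
  obtain T L where TL: "psi_quinv m mu G = (T, L)" by fastforce
  note IH = Suc.IH[OF d(2,3), unfolded TL fst_conv snd_conv]
  let ?g = "\<lambda>i. word_part (word (Suc m) i (columns (Suc m) lam F))"
  have d4: "\<forall>i\<in>{1..m}. ?g i \<in> fits (lam i - mu i) (mu i - lam (Suc i))" using d(4) by blast
  note P = POP_Suc_intro[where g = ?g, OF Suc.prems(1) d(1) IH[THEN conjunct1] d4]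
  have e: "psi_quinv (Suc m) lam F = (\<lambda>(i, j)\<in>triangle (Suc m). if j = Suc m then lam i else T (i, j),
    \<lambda>(i, j)\<in>overlay_index (Suc m). if j = m then word_part (word (Suc m) i (columns (Suc m) lam F)) else L (i, j))"
    by (simp add: psi_quinv.simps(2) ds TL)
  have "fst (psi_quinv (Suc m) lam F) = gt_of_tableau (Suc m) lam F"
    unfolding e d(6) fst_conv using IH by metis
  moreover have "quinv_stat (Suc m) lam F = int (overlay_size (Suc m) (snd (psi_quinv (Suc m) lam F)))"
    unfolding e snd_conv P(3) d(5) IH[THEN conjunct2, THEN conjunct2] by simp
  ultimately show ?case using P(1) unfolding e by blast
qed

lemma psi_quinv_br:
  assumes "lam \<in> partitions (Suc m)" "F \<in> CSF (Suc m) lam" "dsplice (Suc m) lam F = (mu, G)"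
  shows "br (Suc m) (psi_quinv (Suc m) lam F) = (mu, psi_quinv m mu G)"
proof -
  note d = dsplice_facts[OF assms]
  obtain T L where TL: "psi_quinv m mu G = (T, L)" by fastforce
  let ?g = "\<lambda>i. word_part (word (Suc m) i (columns (Suc m) lam F))"
  have d4: "\<forall>i\<in>{1..m}. ?g i \<in> fits (lam i - mu i) (mu i - lam (Suc i))" using d(4) by blast
  have "(T, L) \<in> POP m mu" using psi_quinv_properties[OF d(2,3)] unfolding TL by blast
  note P = POP_Suc_intro[where g = ?g, OF assms(1) d(1) this d4]
  show ?thesis unfolding TL P(2)[symmetric] by (simp add: psi_quinv.simps(2) assms(3) TL)
qed

text \<open>From the image, \<open>br\<close> gives back \<open>mu\<close> and the value at
  \<open>G\<close>, hence \<open>G\<close> by induction, while the overlay row \<open>m\<close>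
  gives back the words.\<close>

lemma psi_quinv_inj:
  assumes "lam \<in> partitions n"
  shows "inj_on (psi_quinv n lam) (CSF n lam)"
  using assms
proof (induction n arbitrary: lam)
  case 0
  have "dg 0 lam = {}" by (auto simp: dg_def)
  then show ?case by (auto simp: inj_on_def CSF_def fillings_def)
next
  case (Suc m)
  show ?case
  proof (rule inj_onI)
    fix F F' assume F: "F \<in> CSF (Suc m) lam" and F': "F' \<in> CSF (Suc m) lam"
      and eq: "psi_quinv (Suc m) lam F = psi_quinv (Suc m) lam F'"
    obtain mu G mu' G' where ds: "dsplice (Suc m) lam F = (mu, G)" "dsplice (Suc m) lam F' = (mu', G')"
      by fastforce
    have p: "(mu, psi_quinv m mu G) = (mu', psi_quinv m mu' G')"
      unfolding psi_quinv_br[OF Suc.prems F ds(1), symmetric] psi_quinv_br[OF Suc.prems F' ds(2), symmetric]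
      by (simp only: eq)
    have e: "mu = mu'" "psi_quinv m mu G = psi_quinv m mu' G'"
      by (rule Pair_inject[OF p], assumption)+
    obtain T L where TL: "psi_quinv m mu G = (T, L)" by fastforce
    have "G = G'"
      using e Suc.IH[of mu] dsplice_facts(2,3)[OF Suc.prems F ds(1)] dsplice_facts(3)[OF Suc.prems F' ds(2)]
      by (auto simp: inj_on_def)
    moreover have "word_part (word (Suc m) i (columns (Suc m) lam F)) =
        word_part (word (Suc m) i (columns (Suc m) lam F'))" if "i \<in> {1..m}" for i
    proof -
      have "(i, m) \<in> overlay_index (Suc m)" using that by (simp add: overlay_index_def)
      then show ?thesis
        using arg_cong[OF eq, of "\<lambda>P. snd P (i, m)"] TL e(2)[symmetric]
        by (simp add: psi_quinv.simps(2) ds)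
    qed
    ultimately show "F = F'"
      by (intro dsplice_word_inj[OF Suc.prems F F']) (simp_all add: ds e)
  qed
qed

lemma POP_Suc_elim:
  assumes "(T, L) \<in> POP (Suc m) lam"
  obtains mu T' L' g where "mu \<in> interlacing (Suc m) lam" "(T', L') \<in> POP m mu"
    "\<forall>i\<in>{1..m}. g i \<in> fits (lam i - mu i) (mu i - lam (Suc i))"
    "T = (\<lambda>(i, j)\<in>triangle (Suc m). if j = Suc m then lam i else T' (i, j))"
    "L = (\<lambda>(i, j)\<in>overlay_index (Suc m). if j = m then g i else L' (i, j))"
proof -
  define mu where "mu = (\<lambda>i\<in>{1..m}. T (i, m))"
  define T' where "T' = restrict T (triangle m)"
  define L' where "L' = restrict L (overlay_index m)"
  have T: "T \<in> triangle (Suc m) \<rightarrow>\<^sub>E UNIV" "\<And>i. i \<in> {1..Suc m} \<Longrightarrow> T (i, Suc m) = lam i"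
    "\<And>i j. 1 \<le> i \<Longrightarrow> i \<le> j \<Longrightarrow> j < Suc m \<Longrightarrow> T (i, j) \<le> T (i, Suc j) \<and> T (Suc i, Suc j) \<le> T (i, j)"
    and L: "L \<in> PiE (overlay_index (Suc m)) (\<lambda>(i, j). fits (NE T i j) (SE T i j))"
    using assms by (auto simp: POP_def GT_def)
  have mu: "mu \<in> interlacing (Suc m) lam"
    using T(2) T(3)[of _ m] by (auto simp: interlacing_def mu_def)
  have "T' \<in> GT m mu"
    using T(3) by (auto simp: GT_def T'_def mu_def triangle_def)
  moreover have "L' \<in> PiE (overlay_index m) (\<lambda>(i, j). fits (NE T' i j) (SE T' i j))"
  proof -
    have "L (i, j) \<in> fits (NE T' i j) (SE T' i j)" if ij: "(i, j) \<in> overlay_index m" for i j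
    proof -
      have "(i, j) \<in> overlay_index (Suc m)" "NE T' i j = NE T i j" "SE T' i j = SE T i j"
        using ij by (auto simp: overlay_index_def NE_def SE_def T'_def triangle_def)
      then show ?thesis using L by auto
    qed
    then show ?thesis by (auto simp: L'_def)
  qed
  ultimately have TL: "(T', L') \<in> POP m mu" by (simp add: POP_def)
  have fits: "\<forall>i\<in>{1..m}. L (i, m) \<in> fits (lam i - mu i) (mu i - lam (Suc i))"
  proof
    fix i assume i: "i \<in> {1..m}"
    have "(i, m) \<in> overlay_index (Suc m)" using i by (simp add: overlay_index_def)
    then have "L (i, m) \<in> fits (NE T i m) (SE T i m)" using L by fastforce
    then show "L (i, m) \<in> fits (lam i - mu i) (mu i - lam (Suc i))"
      using i T(2)[of i] T(2)[of "Suc i"] by (simp add: NE_def SE_def mu_def)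
  qed
  have T_eq: "T = (\<lambda>(i, j)\<in>triangle (Suc m). if j = Suc m then lam i else T' (i, j))"
    by (rule extensionalityI[of _ "triangle (Suc m)"])
       (use T(1,2) in \<open>auto simp: PiE_def T'_def triangle_def\<close>)
  have L_eq: "L = (\<lambda>(i, j)\<in>overlay_index (Suc m). if j = m then L (i, m) else L' (i, j))"
    by (rule extensionalityI[of _ "overlay_index (Suc m)"])
       (use L in \<open>auto simp: PiE_def L'_def overlay_index_def\<close>)
  show ?thesis by (rule that[OF mu TL fits T_eq L_eq])
qed

lemma psi_quinv_surj:
  assumes "lam \<in> partitions n" "P \<in> POP n lam"
  shows "\<exists>F\<in>CSF n lam. psi_quinv n lam F = P"
  using assms
proof (induction n arbitrary: lam P)
  case 0
  have "overlay_index 0 = {}" "triangle 0 = {}" "dg 0 lam = {}"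
    by (auto simp: overlay_index_def triangle_def dg_def)
  then have "P = (\<lambda>_. undefined, \<lambda>_. undefined)" "(\<lambda>_. undefined) \<in> CSF 0 lam"
    using 0(2) by (auto simp: POP_def GT_def CSF_def fillings_def column_strict_def)
  then show ?case by auto
next
  case (Suc m)
  obtain T L where P: "P = (T, L)" by (cases P)
  obtain mu T' L' g where e: "mu \<in> interlacing (Suc m) lam"
    "(T', L') \<in> POP m mu" "\<forall>i\<in>{1..m}. g i \<in> fits (lam i - mu i) (mu i - lam (Suc i))"
    "T = (\<lambda>(i, j)\<in>triangle (Suc m). if j = Suc m then lam i else T' (i, j))"
    "L = (\<lambda>(i, j)\<in>overlay_index (Suc m). if j = m then g i else L' (i, j))"
    by (rule POP_Suc_elim[OF Suc.prems(2)[unfolded P]])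
  obtain G where G: "G \<in> CSF m mu" "psi_quinv m mu G = (T', L')"
    using Suc.IH[OF interlacing_partitions[OF e(1)] e(2)] by blast
  obtain F where F: "F \<in> CSF (Suc m) lam" "dsplice (Suc m) lam F = (mu, G)"
    "\<And>i. i \<in> {1..m} \<Longrightarrow> word_part (word (Suc m) i (columns (Suc m) lam F)) = g i"
    using dsplice_word_surj[OF Suc.prems(1) e(1) G(1) e(3)[rule_format]] by blast
  have "(\<lambda>(i, j)\<in>overlay_index (Suc m).
      if j = m then word_part (word (Suc m) i (columns (Suc m) lam F)) else L' (i, j)) =
    (\<lambda>(i, j)\<in>overlay_index (Suc m). if j = m then g i else L' (i, j))"
    by (rule restrict_ext) (use F(3) in \<open>auto simp: overlay_index_def\<close>)
  then have "psi_quinv (Suc m) lam F = P"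
    unfolding P e(4,5) by (simp add: psi_quinv.simps(2) F(2) G(2))
  then show ?case using F(1) by blast
qed

lemma bij_betw_psi_quinv:
  assumes "lam \<in> partitions n"
  shows "bij_betw (psi_quinv n lam) (CSF n lam) (POP n lam)"
  unfolding bij_betw_def
  using psi_quinv_inj[OF assms] psi_quinv_properties[OF assms] psi_quinv_surj[OF assms] by blast

section \<open>The inv family by complementation\<close>

definition psi_inv :: "nat \<Rightarrow> part \<Rightarrow> filling \<Rightarrow> pop" where
  "psi_inv n lam F = bcomp n (psi_quinv n lam F)"

lemma bij_betw_psi_inv:
  assumes "lam \<in> partitions n"
  shows "bij_betw (psi_inv n lam) (CSF n lam) (POP n lam)"
  using bij_betw_trans[OF bij_betw_psi_quinv[OF assms] bij_betw_bcomp]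
  by (simp add: psi_inv_def[abs_def] o_def)

text \<open>For the common pattern \<open>T\<close>, inv and quinv on one side, and the sizes of an
  overlay and of its complement on the other, have the same sum; the quinv identity cancels.\<close>

lemma inv_stat_psi_inv:
  assumes "n \<ge> 1" "lam \<in> partitions n" "F \<in> CSF n lam"
  shows "inv_stat n lam F = int (overlay_size n (snd (psi_inv n lam F)))"
proof -
  obtain T L where TL: "psi_quinv n lam F = (T, L)" by fastforce
  note p = psi_quinv_properties[OF assms(2,3), unfolded TL fst_conv snd_conv]
  have "inv_stat n lam F + quinv_stat n lam F = int (\<Sum>(i, j)\<in>overlay_index n. NE T i j * SE T i j)"
    using inv_plus_quinv[OF columns_facts(2)[OF assms]] columns_facts(3,4)[OF assms] p by simp
  moreover have "overlay_size n (snd (psi_inv n lam F)) + overlay_size n L =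
    (\<Sum>(i, j)\<in>overlay_index n. NE T i j * SE T i j)"
    using overlay_size_bcomp[OF p[THEN conjunct1]] by (simp add: psi_inv_def TL)
  ultimately show ?thesis using p[THEN conjunct2, THEN conjunct2] by linarith
qed

theorem theorem1:
  "\<exists>(psi_inv :: nat \<Rightarrow> part \<Rightarrow> filling \<Rightarrow> pop) (psi_quinv :: nat \<Rightarrow> part \<Rightarrow> filling \<Rightarrow> pop).
     (\<forall>n. \<forall>lam\<in>partitions n.
        bij_betw (psi_inv n lam) (CSF n lam) (POP n lam) \<and>
        bij_betw (psi_quinv n lam) (CSF n lam) (POP n lam)) \<and>
     (\<forall>n\<ge>1. \<forall>lam\<in>partitions n.
        (\<forall>(v, psi)\<in>{(inv_stat, psi_inv), (quinv_stat, psi_quinv)}.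
           (\<forall>F\<in>CSF n lam. \<forall>T L. psi n lam F = (T, L) \<longrightarrow>
              xweight n lam F = xweight_gt n lam T \<and>
              v n lam F = int (overlay_size n L)) \<and>
           (\<forall>F\<in>CSF n lam.
              pr (psi n lam F) = gt_of_tableau n lam (rsort n lam F)) \<and>
           dsplice n lam \<in> CSF n lam \<rightarrow> (SIGMA mu:interlacing n lam. CSF (n - 1) mu) \<and>
           (\<forall>F\<in>CSF n lam.
              br n (psi n lam F) =
                (case dsplice n lam F of (mu, G) \<Rightarrow> (mu, psi (n - 1) mu G)))) \<and>
        (\<forall>F\<in>CSF n lam. psi_quinv n lam F = bcomp n (psi_inv n lam F)))"
proof (rule exI[of _ psi_inv], rule exI[of _ psi_quinv], intro conjI allI impI ballI)
  fix n lam assume "lam \<in> partitions n"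
  then show "bij_betw (psi_inv n lam) (CSF n lam) (POP n lam)"
    "bij_betw (psi_quinv n lam) (CSF n lam) (POP n lam)"
    by (rule bij_betw_psi_inv, rule bij_betw_psi_quinv)
next
  fix n :: nat and lam F assume a: "1 \<le> n" "lam \<in> partitions n" "F \<in> CSF n lam"
  show "psi_quinv n lam F = bcomp n (psi_inv n lam F)"
    unfolding psi_inv_def using psi_quinv_properties[OF a(2,3)] bcomp_bcomp by metis
next
  fix n :: nat and lam x
  assume n: "1 \<le> n" and lam: "lam \<in> partitions n" and x: "x \<in> {(inv_stat, psi_inv), (quinv_stat, psi_quinv)}"
  obtain m where m: "n = Suc m" using n by (cases n) auto
  obtain v psi where vp: "x = (v, psi)" by (cases x)
  have fst_psi: "fst (psi n lam F) = gt_of_tableau n lam F"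
    and v: "v n lam F = int (overlay_size n (snd (psi n lam F)))" if "F \<in> CSF n lam" for F
    using x psi_quinv_properties[OF lam that] inv_stat_psi_inv[OF n lam that] by (auto simp: vp psi_inv_def)
  \<comment> \<open>For \<open>psi_inv\<close> the claim follows from that for
    \<open>psi_quinv\<close>, because complementation commutes with \<open>br\<close>.\<close>
  have "br n (psi n lam F) = (mu, psi m mu G)" if "F \<in> CSF n lam" "dsplice n lam F = (mu, G)" for F mu G
    using x psi_quinv_br[OF lam[unfolded m] that[unfolded m]]
      br_bcomp[OF psi_quinv_br[OF lam[unfolded m] that[unfolded m]]] by (auto simp: vp psi_inv_def m)
  moreover have "dsplice n lam F \<in> (SIGMA mu:interlacing n lam. CSF (n - 1) mu)" if F: "F \<in> CSF n lam" for F
  proof -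
    obtain mu G where ds: "dsplice n lam F = (mu, G)" by fastforce
    show ?thesis
      unfolding ds using dsplice_facts(1,3)[OF lam[unfolded m] F[unfolded m] ds[unfolded m]] by (simp add: m)
  qed
  moreover have "xweight n lam F = xweight_gt n lam T \<and> v n lam F = int (overlay_size n L)"
    if "F \<in> CSF n lam" "psi n lam F = (T, L)" for F T L
    using fst_psi[OF that(1)] v[OF that(1)] xweight_gt_of_tableau[OF lam that(1)] that(2) by simp
  ultimately show "case x of (v, psi) \<Rightarrow>
      (\<forall>F\<in>CSF n lam. \<forall>T L. psi n lam F = (T, L) \<longrightarrow>
         xweight n lam F = xweight_gt n lam T \<and> v n lam F = int (overlay_size n L)) \<and>
      (\<forall>F\<in>CSF n lam. pr (psi n lam F) = gt_of_tableau n lam (rsort n lam F)) \<and>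
      dsplice n lam \<in> CSF n lam \<rightarrow> (SIGMA mu:interlacing n lam. CSF (n - 1) mu) \<and>
      (\<forall>F\<in>CSF n lam. br n (psi n lam F) = (case dsplice n lam F of (mu, G) \<Rightarrow> (mu, psi (n - 1) mu G)))"
    using fst_psi by (auto simp: vp pr_def gt_of_tableau_rsort m split: prod.split)
qed

end
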